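(* Let $\vec\ell\in\mathcal W^N_{\mathbb R}$ and $p\in\mathbb C\setminus\{\ell_1,\dots,\ell_N\}$. For $u_1,\dots,u_k,v_1,\dots,v_k\in\mathbb C$ pairwise distinct, $$\frac{\mathcal B_{\vec\ell,p}(u_1,\dots,u_k,0^N/v_1,\dots,v_k)}{\mathcal B_{\vec\ell}(0^N)}=\frac{\prod_{i,j=1}^k(u_i-v_j)}{\prod_{1\le i<j\le k}(u_i-u_j)(v_j-v_i)}\det\Big(\frac1{u_i-v_j}\frac{\mathcal B_{\vec\ell,p}(u_i,0^N/v_j)}{\mathcal B_{\vec\ell}(0^N)}\Big)_{i,j=1}^k.$$ If $u,v\in\mathbb C\setminus\{0\}$ with $u\ne v$, then $$\frac{\mathcal B_{\vec\ell,p}(u,0^N/v)}{\mathcal B_{\vec\ell}(0^N)}=(u-v)\Big(\frac vu\Big)^N\Big(\frac{e^{p(u-v)}}{u-v}+\int_p^\infty dw\oint\frac{dz}{2\pi\mathrm i}\frac1{w-z}\frac{e^{zu}}{e^{wv}}\prod_{i=1}^N\frac{w-\ell_i}{z-\ell_i}\Big),$$ where the $z$-contour is positively oriented around $\ell_1,\dots,\ell_N$, and the $w$-contour is a ray from $p$ to $\infty$ disjoint from the $z$-contour with $\operatorname{Re}(wv)>0$ for $|w|$ large. (When $\vec\ell$ has repeated coordinates, the ratios are understood by continuity in $\vec\ell$.)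
   Context: $\mathcal B_{\vec\ell}(z_1,\dots,z_N)=\det(e^{z_i\ell_j})/\prod_{i<j}(z_i-z_j)$, extended by continuity; $0^N$ denotes $N$ arguments equal to $0$. For $\vec u=(u_1,\dots,u_{N+k})$, $\vec v=(v_1,\dots,v_k)$, $$\mathcal B_{\vec\ell,p}(\vec u/\vec v)=(-1)^{Nk}\frac{\prod_{i,j}(u_i-v_j)}{\prod_{i<j}(u_i-u_j)\prod_{i<j}(v_j-v_i)}\det\Big(\Big(\frac{e^{p(u_i-v_j)}}{u_i-v_j}\Big)_{j\le k}\ \ \big(e^{u_i\ell_j}\big)_{j\le N}\Big)_{i=1}^{N+k},$$ an $(N+k)\times(N+k)$ determinant, extended analytically to all arguments.
   Formalization: The ray condition "Re(wv)>0 for |w| large" is taken as Re(dv)>0, where d is the direction of the ray from p; the boundary case Re(dv)=0 with Re(pv)>0 is excluded because the w-integral diverges there (e.g. N=1, ℓ=0, p=v=1, d=i). *)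

theory Defs
  imports "HOL-Complex_Analysis.Complex_Analysis"
begin

(* Vectors of length n are functions nat => _ of which only the entries 0..n-1 matter
   (entry i-1 corresponds to the paper's i-th coordinate).  Topology on nat => _ is
   the product topology of HOL-Analysis.Function_Topology. *)

definition detn :: "nat \<Rightarrow> (nat \<Rightarrow> nat \<Rightarrow> complex) \<Rightarrow> complex" where
  "detn n A = (\<Sum>\<sigma> | \<sigma> permutes {..<n}. of_int (sign \<sigma>) * (\<Prod>i<n. A i (\<sigma> i)))"

definition distinct_upto :: "nat \<Rightarrow> (nat \<Rightarrow> 'a) \<Rightarrow> bool" where
  "distinct_upto n z \<longleftrightarrow> inj_on z {..<n}"

definition weyl :: "nat \<Rightarrow> (nat \<Rightarrow> real) \<Rightarrow> bool" where
  "weyl n l \<longleftrightarrow> (\<forall>i j. i \<le> j \<longrightarrow> j < n \<longrightarrow> l j \<le> l i)"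

definition weyl_strict :: "nat \<Rightarrow> (nat \<Rightarrow> real) \<Rightarrow> bool" where
  "weyl_strict n l \<longleftrightarrow> (\<forall>i j. i < j \<longrightarrow> j < n \<longrightarrow> l j < l i)"

definition B_raw :: "nat \<Rightarrow> (nat \<Rightarrow> real) \<Rightarrow> (nat \<Rightarrow> complex) \<Rightarrow> complex" where
  "B_raw n l z = detn n (\<lambda>i j. exp (z i * of_real (l j)))
                 / (\<Prod>(i,j) \<in> {(i,j). i < j \<and> j < n}. (z i - z j))"

definition B :: "nat \<Rightarrow> (nat \<Rightarrow> real) \<Rightarrow> (nat \<Rightarrow> complex) \<Rightarrow> complex" where
  "B n l z = (if distinct_upto n z then B_raw n l z
     else Lim (at z within {z'. distinct_upto n z' \<and> (\<forall>i\<ge>n. z' i = z i)}) (B_raw n l))"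

definition Bp_raw :: "nat \<Rightarrow> nat \<Rightarrow> (nat \<Rightarrow> real) \<Rightarrow> complex \<Rightarrow>
    (nat \<Rightarrow> complex) \<times> (nat \<Rightarrow> complex) \<Rightarrow> complex" where
  "Bp_raw n k l p uv = (let u = fst uv; v = snd uv in
     (-1) ^ (n * k) *
     (\<Prod>i<n+k. \<Prod>j<k. (u i - v j))
     / ((\<Prod>(i,j) \<in> {(i,j). i < j \<and> j < n + k}. (u i - u j))
        * (\<Prod>(i,j) \<in> {(i,j). i < j \<and> j < k}. (v j - v i)))
     * detn (n + k) (\<lambda>i j. if j < k then exp (p * (u i - v j)) / (u i - v j)
                            else exp (u i * of_real (l (j - k)))))"

definition generic_uv :: "nat \<Rightarrow> nat \<Rightarrow> (nat \<Rightarrow> complex) \<times> (nat \<Rightarrow> complex) \<Rightarrow> bool" where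
  "generic_uv n k uv \<longleftrightarrow> distinct_upto (n + k) (fst uv) \<and> distinct_upto k (snd uv)
     \<and> (\<forall>i<n+k. \<forall>j<k. fst uv i \<noteq> snd uv j)"

definition Bp :: "nat \<Rightarrow> nat \<Rightarrow> (nat \<Rightarrow> real) \<Rightarrow> complex \<Rightarrow>
    (nat \<Rightarrow> complex) \<Rightarrow> (nat \<Rightarrow> complex) \<Rightarrow> complex" where
  "Bp n k l p u v = (if generic_uv n k (u, v) then Bp_raw n k l p (u, v)
     else Lim (at (u, v) within {uv'. generic_uv n k uv' \<and>
                  (\<forall>i\<ge>n+k. fst uv' i = u i) \<and> (\<forall>j\<ge>k. snd uv' j = v j)})
              (Bp_raw n k l p))"

definition zeros :: "nat \<Rightarrow> complex" where "zeros = (\<lambda>_. 0)"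

definition ratioB :: "nat \<Rightarrow> (nat \<Rightarrow> real) \<Rightarrow> ((nat \<Rightarrow> real) \<Rightarrow> complex) \<Rightarrow> complex" where
  "ratioB n l F = (if weyl_strict n l then F l / B n l zeros
     else Lim (at l within {l'. weyl_strict n l' \<and> (\<forall>i\<ge>n. l' i = l i)})
              (\<lambda>l'. F l' / B n l' zeros))"

end

theory Submission
  imports Defs "Jordan_Normal_Form.Determinant"
begin

text \<open>
  Write \<open>f\<^sub>v(z) = e\<^bsup>p(z-v)\<^esup>/(z-v)\<close> and let \<open>x\<close> be \<open>N\<close> distinct nodes in place of \<open>0\<^sup>N\<close>. A Schur complement
  shows that the determinant defining \<open>B\<^sub>l\<^sub>,\<^sub>p(u,x/v)\<close> equals \<open>det(e\<^bsup>x l\<^esup>)\<close> times the \<open>k \<times> k\<close> determinant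
  of the errors \<open>f\<^sub>v(u) - I\<^sub>v(u)\<close>, where \<open>I\<^sub>v\<close> is the combination of the exponentials \<open>e\<^bsup>l z\<^esup>\<close> that
  interpolates \<open>f\<^sub>v\<close> at the nodes. The entries are the same quantities for \<open>k = 1\<close>, which gives the
  determinantal formula at distinct nodes. Expressing the interpolation conditions by divided
  differences, written as contour integrals over a large circle, makes everything continuous as
  \<open>x \<rightarrow> 0\<close>. At \<open>x = 0\<close> the coefficients of \<open>I\<^sub>v\<close> are the values on the Lagrange basis of the linear
  functional \<open>w\<^sup>i \<mapsto> f\<^sub>v\<^sup>(\<^sup>i\<^sup>)(0)\<close>, up to a power of \<open>v\<close>; passing to the Newton basis removes the
  denominators \<open>l\<^sub>i - l\<^sub>j\<close> and gives continuity in \<open>l\<close>. Finally \<open>f\<^sub>v\<^sup>(\<^sup>i\<^sup>)(0) = -\<integral> w\<^sup>i e\<^bsup>-wv\<^esup> dw\<close> along the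
  ray from \<open>p\<close>, and the \<open>z\<close>-contour integral is the Newton form of the interpolation polynomial
  of \<open>e\<^bsup>zu\<^esup>\<close> because the ray has winding number zero.
\<close>

section \<open>Determinants\<close>

lemma detn_eq_det: "detn n A = Determinant.det (Matrix.mat n n (\<lambda>(i,j). A i j))"
proof -
  have "Determinant.det (Matrix.mat n n (\<lambda>(i,j). A i j))
      = (\<Sum>\<sigma> | \<sigma> permutes {0..<n}. signof \<sigma> * (\<Prod>i = 0..<n. Matrix.mat n n (\<lambda>(i,j). A i j) $$ (i, \<sigma> i)))"
    by (rule det_def') simp
  also have "\<dots> = detn n A"
    unfolding detn_def atLeast0LessThan
    by (intro sum.cong refl arg_cong2[where f = "(*)"] prod.cong)
       (use permutes_in_image in fastforce)+
  finally show ?thesis ..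
qed

lemma detn_cong: "(\<And>i j. i < n \<Longrightarrow> j < n \<Longrightarrow> A i j = A' i j) \<Longrightarrow> detn n A = detn n A'"
  unfolding detn_eq_det by (intro arg_cong[where f = Determinant.det] cong_mat) auto

lemma detn_mult:
  "detn n (\<lambda>i j. \<Sum>m<n. A i m * A' m j) = detn n A * detn n A'"
proof -
  have "Matrix.mat n n (\<lambda>(i,j). A i j) * Matrix.mat n n (\<lambda>(i,j). A' i j)
      = Matrix.mat n n (\<lambda>(i,j). \<Sum>m<n. A i m * A' m j)"
    by (intro eq_matI) (auto simp: scalar_prod_def atLeast0LessThan)
  then show ?thesis
    unfolding detn_eq_det by (subst det_mult[symmetric, of _ n]) auto
qed

lemma detn_scale:
  "detn n (\<lambda>i j. r i * c j * A i j) = (\<Prod>i<n. r i) * (\<Prod>j<n. c j) * detn n A"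
proof -
  have "(\<Prod>i<n. r i * c (\<sigma> i) * A i (\<sigma> i)) = (\<Prod>i<n. r i) * (\<Prod>j<n. c j) * (\<Prod>i<n. A i (\<sigma> i))"
    if "\<sigma> permutes {..<n}" for \<sigma>
    using prod.permute[OF that, of c] by (simp add: prod.distrib o_def)
  then show ?thesis
    unfolding detn_def by (simp add: sum_distrib_left mult_ac)
qed

lemma detn_lower_triangular:
  assumes "\<And>i j. i < j \<Longrightarrow> j < n \<Longrightarrow> A i j = 0"
  shows "detn n A = (\<Prod>i<n. A i i)"
proof -
  have "detn n A = prod_list (diag_mat (Matrix.mat n n (\<lambda>(i,j). A i j)))"
    unfolding detn_eq_det by (rule det_lower_triangular[of n]) (use assms in auto)
  also have "\<dots> = (\<Prod>i<n. A i i)"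
    unfolding diag_mat_def by (simp add: prod.list_conv_set_nth atLeast0LessThan)
  finally show ?thesis .
qed

lemma tendsto_detn:
  assumes "\<And>i j. i < n \<Longrightarrow> j < n \<Longrightarrow> ((\<lambda>t. A t i j) \<longlongrightarrow> A0 i j) F"
  shows "((\<lambda>t. detn n (A t)) \<longlongrightarrow> detn n A0) F"
  unfolding detn_def
  by (intro tendsto_sum tendsto_mult tendsto_const tendsto_prod assms)
     (use permutes_in_image in fastforce)+

text \<open>Kept as an explicit quotient of determinants rather than as a chosen solution: the
  coefficients then depend continuously on the entries wherever the determinant in the denominator
  does not vanish.\<close>

definition cramer :: "nat \<Rightarrow> (nat \<Rightarrow> nat \<Rightarrow> complex) \<Rightarrow> (nat \<Rightarrow> complex) \<Rightarrow> nat \<Rightarrow> complex" where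
  "cramer n A b m = detn n (\<lambda>i j. if j = m then b i else A i j) / detn n A"

text \<open>The adjugate gives a right inverse and hence a solution; Cramer's lemma identifies the
  coordinates of that solution with \<open>cramer\<close>.\<close>

lemma cramer_solves:
  assumes "detn n A \<noteq> 0" and "i < n"
  shows "(\<Sum>m<n. A i m * cramer n A b m) = b i"
proof -
  define M where "M = Matrix.mat n n (\<lambda>(i,j). A i j)"
  have M: "M \<in> carrier_mat n n" by (simp add: M_def)
  have d: "Determinant.det M \<noteq> 0" using assms by (simp add: detn_eq_det M_def)
  define X where "X = inverse (Determinant.det M) \<cdot>\<^sub>m adj_mat M"
  have X: "X \<in> carrier_mat n n" using adj_mat(1)[OF M] by (simp add: X_def)
  have MX: "M * X = 1\<^sub>m n"
    using adj_mat[OF M] d M by (auto simp: X_def mult_smult_distrib)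
  define y where "y = X *\<^sub>v Matrix.vec n b"
  have y: "y \<in> carrier_vec n" using X by (simp add: y_def)
  have My: "M *\<^sub>v y = Matrix.vec n b"
    unfolding y_def using assoc_mult_mat_vec[OF M X, of "Matrix.vec n b"] MX by simp
  have c: "cramer n A b m = vec_index y m" if m: "m < n" for m
  proof -
    have "Determinant.det (replace_col M (M *\<^sub>v y) m) = vec_index y m * Determinant.det M"
      by (rule cramer_lemma_mat[OF M y m])
    moreover have "replace_col M (M *\<^sub>v y) m
        = Matrix.mat n n (\<lambda>(i,j). if j = m then b i else A i j)"
      unfolding My by (intro eq_matI) (auto simp: replace_col_def M_def)
    ultimately show ?thesis
      using d by (simp add: cramer_def detn_eq_det M_def field_simps)
  qed
  have "(\<Sum>m<n. A i m * cramer n A b m) = vec_index (M *\<^sub>v y) i"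
    using assms(2) y by (simp add: c scalar_prod_def M_def atLeast0LessThan)
  then show ?thesis using assms(2) by (simp add: My)
qed

text \<open>Schur complement: the matrix is the product of the block matrices ((K, X), (0, E)) and
  ((1, 0), (c, 1)), where K = F - X c on the first \<open>k\<close> rows and \<open>c\<close> solves
  E c = F on the last \<open>n\<close> rows. The second factor has determinant 1.\<close>

lemma detn_bordered:
  assumes c: "\<And>a j. a < n \<Longrightarrow> j < k \<Longrightarrow> (\<Sum>m<n. E a m * c m j) = F (k + a) j"
  shows "detn (n + k) (\<lambda>i j. if j < k then F i j else if i < k then X i (j - k) else E (i - k) (j - k))
       = detn n E * detn k (\<lambda>i j. F i j - (\<Sum>m<n. X i m * c m j))"
proof -
  define K where "K = Matrix.mat k k (\<lambda>(i,j). F i j - (\<Sum>m<n. X i m * c m j))"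
  define X' where "X' = Matrix.mat k n (\<lambda>(i,j). X i j)"
  define E' where "E' = Matrix.mat n n (\<lambda>(i,j). E i j)"
  define c' where "c' = Matrix.mat n k (\<lambda>(i,j). c i j)"
  define L where "L = four_block_mat K X' (0\<^sub>m n k) E'"
  define R where "R = four_block_mat (1\<^sub>m k) (0\<^sub>m k n) c' (1\<^sub>m n)"
  note defs = K_def X'_def E'_def c'_def
  have LR: "L \<in> carrier_mat (k + n) (k + n)" "R \<in> carrier_mat (k + n) (k + n)"
    by (auto simp: L_def R_def defs intro!: four_block_carrier_mat)
  have "L * R = four_block_mat (K * 1\<^sub>m k + X' * c') (K * 0\<^sub>m k n + X' * 1\<^sub>m n)
      (0\<^sub>m n k * 1\<^sub>m k + E' * c') (0\<^sub>m n k * 0\<^sub>m k n + E' * 1\<^sub>m n)"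
    unfolding L_def R_def by (rule mult_four_block_mat) (auto simp: defs)
  also have "\<dots> = Matrix.mat (n + k) (n + k) (\<lambda>(i,j). if j < k then F i j
      else if i < k then X i (j - k) else E (i - k) (j - k))"
  proof (rule eq_matI, goal_cases)
    case (1 i j)
    then show ?case using c[of "i - k" j]
      by (auto simp: defs scalar_prod_def atLeast0LessThan)
  qed (auto simp: defs)
  finally have "detn (n + k) (\<lambda>i j. if j < k then F i j else if i < k then X i (j - k) else E (i - k) (j - k))
     = Determinant.det (L * R)"
    by (simp add: detn_eq_det)
  also have "\<dots> = Determinant.det L * Determinant.det R"
    by (rule det_mult) (use LR in auto)
  also have "Determinant.det L = Determinant.det K * Determinant.det E'"
    unfolding L_def by (rule det_four_block_mat_lower_left_zero[of _ k _ n]) (auto simp: defs)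
  also have "Determinant.det R = 1"
    unfolding R_def by (subst det_four_block_mat_upper_right_zero[of _ k _ n]) (auto simp: defs)
  finally show ?thesis by (simp add: detn_eq_det defs mult.commute)
qed

text \<open>A nonzero kernel vector of the transpose, scaled by the row factors \<open>a i\<close>,
  would be the coefficient vector of a nonzero polynomial of degree below \<open>n\<close> with the
  \<open>n\<close> distinct roots \<open>l j\<close>.\<close>

lemma detn_vandermonde_nonzero:
  assumes "inj_on l {..<n}" and "\<And>i. i < n \<Longrightarrow> a i \<noteq> 0"
  shows "detn n (\<lambda>i j. a i * l j ^ i) \<noteq> 0"
proof
  assume "detn n (\<lambda>i j. a i * l j ^ i) = 0"
  define M where "M = Matrix.mat n n (\<lambda>(i,j). a i * l j ^ i)"
  have M: "M \<in> carrier_mat n n" "transpose_mat M \<in> carrier_mat n n" by (auto simp: M_def)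
  have "Determinant.det (transpose_mat M) = 0"
    using \<open>detn n _ = 0\<close> det_transpose[OF M(1)] by (simp add: detn_eq_det M_def)
  then obtain c where c: "c \<in> carrier_vec n" "c \<noteq> 0\<^sub>v n" "transpose_mat M *\<^sub>v c = 0\<^sub>v n"
    using det_0_iff_vec_prod_zero_field[OF M(2)] by auto
  define q where "q = (\<Sum>i<n. monom (a i * vec_index c i) i)"
  have coeff_q: "coeff q i = (if i < n then a i * vec_index c i else 0)" for i
    by (auto simp: q_def coeff_sum)
  have root: "poly q (l j) = 0" if "j < n" for j
  proof -
    have "vec_index (transpose_mat M *\<^sub>v c) j = poly q (l j)"
      using that c(1)
      by (simp add: M_def q_def scalar_prod_def poly_sum poly_monom atLeast0LessThan mult_ac)
    then show ?thesis using that c(3) by simp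
  qed
  obtain i where "i < n" "vec_index c i \<noteq> 0"
    using c(1,2) by (metis carrier_vecD eq_vecI index_zero_vec)
  then have "coeff q i \<noteq> 0" using assms(2) by (simp add: coeff_q)
  then have "q \<noteq> 0" by auto
  have "degree q \<le> n - 1" by (rule degree_le) (auto simp: coeff_q)
  moreover have "n \<le> degree q"
  proof -
    have "n = card (l ` {..<n})" using assms(1) by (simp add: card_image)
    also have "\<dots> \<le> card {x. poly q x = 0}"
      by (rule card_mono) (use root poly_roots_finite[OF \<open>q \<noteq> 0\<close>] in auto)
    also have "\<dots> \<le> degree q" by (rule card_poly_roots_bound[OF \<open>q \<noteq> 0\<close>])
    finally show ?thesis .
  qed
  ultimately show False using \<open>i < n\<close> by simp
qed

section \<open>Divided differences\<close>

text \<open>For distinct nodes inside \<open>g\<close> this is the divided difference; unlike the explicit sum \<open>DD\<close>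
  it also makes sense for coinciding nodes.\<close>

definition ddc :: "(real \<Rightarrow> complex) \<Rightarrow> (complex \<Rightarrow> complex) \<Rightarrow> complex list \<Rightarrow> complex" where
  "ddc g \<phi> ys = contour_integral g (\<lambda>z. \<phi> z / (\<Prod>y\<leftarrow>ys. z - y)) / (2 * of_real pi * \<i>)"

definition DD :: "(complex \<Rightarrow> complex) \<Rightarrow> complex set \<Rightarrow> complex" where
  "DD \<phi> Y = (\<Sum>y\<in>Y. \<phi> y / (\<Prod>y'\<in>Y - {y}. y - y'))"

lemma prod_list_diff_eq_0_iff: "(\<Prod>y\<leftarrow>ys. z - y) = 0 \<longleftrightarrow> z \<in> set (ys :: complex list)"
  by (induction ys) auto

lemma holomorphic_on_prod_list_diff [holomorphic_intros]:
  "(\<lambda>z. \<Prod>y\<leftarrow>ys. z - y) holomorphic_on S"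
  by (induction ys) (auto intro!: holomorphic_intros)

lemma ddc_integrand_holomorphic:
  assumes "\<phi> holomorphic_on UNIV"
  shows "(\<lambda>z. \<phi> z / (\<Prod>y\<leftarrow>ys. z - y)) holomorphic_on - set ys"
  by (intro holomorphic_intros holomorphic_on_subset[OF assms])
     (auto simp: prod_list_diff_eq_0_iff)

lemma ddc_integrable:
  assumes "\<phi> holomorphic_on UNIV" "valid_path g" "path_image g \<inter> set ys = {}"
  shows "(\<lambda>z. \<phi> z / (\<Prod>y\<leftarrow>ys. z - y)) contour_integrable_on g"
  by (rule contour_integrable_holomorphic_simple[OF ddc_integrand_holomorphic])
     (use assms in \<open>auto intro!: open_Compl finite_imp_closed\<close>)

lemma ddc_eq_sum_residue:
  assumes "\<phi> holomorphic_on UNIV" "valid_path g" "pathfinish g = pathstart g"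
    and "\<And>y. y \<in> set ys \<Longrightarrow> y \<notin> path_image g"
  shows "ddc g \<phi> ys
    = (\<Sum>y\<in>set ys. winding_number g y * residue (\<lambda>z. \<phi> z / (\<Prod>y\<leftarrow>ys. z - y)) y)"
proof -
  have "contour_integral g (\<lambda>z. \<phi> z / (\<Prod>y\<leftarrow>ys. z - y))
     = 2 * pi * \<i> * (\<Sum>y\<in>set ys. winding_number g y * residue (\<lambda>z. \<phi> z / (\<Prod>y\<leftarrow>ys. z - y)) y)"
    by (rule Residue_theorem[of UNIV])
       (use assms ddc_integrand_holomorphic[OF assms(1), of ys] in \<open>auto simp: Compl_eq_Diff_UNIV\<close>)
  then show ?thesis by (simp add: ddc_def)
qed

text \<open>Only the winding numbers around the nodes enter the residue sum. This is what allows an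
  arbitrary contour around the nodes to be exchanged for a circle.\<close>

lemma ddc_path_independent:
  assumes "\<phi> holomorphic_on UNIV"
    and "valid_path g" "pathfinish g = pathstart g"
    and "\<And>y. y \<in> set ys \<Longrightarrow> y \<notin> path_image g \<and> winding_number g y = 1"
    and "valid_path h" "pathfinish h = pathstart h"
    and "\<And>y. y \<in> set ys \<Longrightarrow> y \<notin> path_image h \<and> winding_number h y = 1"
  shows "ddc g \<phi> ys = ddc h \<phi> ys"
  using assms by (simp add: ddc_eq_sum_residue cong: sum.cong)

text \<open>Distinct nodes give simple poles, whose residues are the summands of
  \<open>DD\<close>.\<close>

lemma ddc_distinct:
  assumes "\<phi> holomorphic_on UNIV" "valid_path g" "pathfinish g = pathstart g"
    and "\<And>y. y \<in> set ys \<Longrightarrow> y \<notin> path_image g \<and> winding_number g y = 1"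
    and "distinct ys"
  shows "ddc g \<phi> ys = DD \<phi> (set ys)"
proof -
  have "residue (\<lambda>z. \<phi> z / (\<Prod>y\<leftarrow>ys. z - y)) y = \<phi> y / (\<Prod>y'\<in>set ys - {y}. y - y')"
    if y: "y \<in> set ys" for y
  proof -
    let ?S = "- (set ys - {y})"
    have eq: "(\<lambda>z. \<phi> z / (\<Prod>y\<leftarrow>ys. z - y)) = (\<lambda>z. (\<phi> z / (\<Prod>y'\<in>set ys - {y}. z - y')) / (z - y))"
    proof
      fix z
      have "(\<Prod>y\<leftarrow>ys. z - y) = (\<Prod>y\<in>set ys. z - y)"
        using assms(5) by (simp add: prod.distinct_set_conv_list)
      also have "\<dots> = (z - y) * (\<Prod>y'\<in>set ys - {y}. z - y')"
        using y by (simp add: prod.remove)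
      finally show "\<phi> z / (\<Prod>y\<leftarrow>ys. z - y) = (\<phi> z / (\<Prod>y'\<in>set ys - {y}. z - y')) / (z - y)"
        by simp
    qed
    have "open ?S" by (intro open_Compl finite_imp_closed) simp
    moreover have "(\<lambda>z. \<phi> z / (\<Prod>y'\<in>set ys - {y}. z - y')) holomorphic_on ?S"
      by (intro holomorphic_intros holomorphic_on_subset[OF assms(1)]) auto
    ultimately show ?thesis unfolding eq
      by (intro residue_simple[of ?S]) auto
  qed
  then show ?thesis
    using assms by (simp add: ddc_eq_sum_residue DD_def)
qed

lemma ddc_perm:
  assumes "mset xs = mset ys"
  shows "ddc g \<phi> xs = ddc g \<phi> ys"
proof -
  have "(\<Prod>y\<leftarrow>xs. z - y) = (\<Prod>y\<leftarrow>ys. z - y)" for z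
    using assms mset_map[of "(-) z" xs] mset_map[of "(-) z" ys]
    by (simp flip: prod_mset_prod_list)
  then show ?thesis by (simp add: ddc_def)
qed

text \<open>Partial fractions for the integrand, pointwise on the path. The identity therefore also
  covers coinciding nodes and nodes outside the contour.\<close>

lemma ddc_recurrence:
  assumes "\<phi> holomorphic_on UNIV" "valid_path g" "path_image g \<inter> set (a # b # ys) = {}"
  shows "(a - b) * ddc g \<phi> (a # b # ys) = ddc g \<phi> (a # ys) - ddc g \<phi> (b # ys)"
proof -
  have int: "(\<lambda>z. \<phi> z / (\<Prod>y\<leftarrow>zs. z - y)) contour_integrable_on g" if "set zs \<subseteq> set (a # b # ys)" for zs
    using assms that by (intro ddc_integrable) auto
  have "contour_integral g (\<lambda>z. \<phi> z / (\<Prod>y\<leftarrow>a # ys. z - y)) - contour_integral g (\<lambda>z. \<phi> z / (\<Prod>y\<leftarrow>b # ys. z - y))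
      = contour_integral g (\<lambda>z. \<phi> z / (\<Prod>y\<leftarrow>a # ys. z - y) - \<phi> z / (\<Prod>y\<leftarrow>b # ys. z - y))"
    by (rule contour_integral_diff[symmetric]; rule int) auto
  also have "\<dots> = contour_integral g (\<lambda>z. (a - b) * (\<phi> z / (\<Prod>y\<leftarrow>a # b # ys. z - y)))"
  proof (rule contour_integral_eq)
    fix z assume "z \<in> path_image g"
    then have "z - a \<noteq> 0" "z - b \<noteq> 0" "(\<Prod>y\<leftarrow>ys. z - y) \<noteq> 0"
      using assms(3) by (auto simp: prod_list_diff_eq_0_iff)
    then show "\<phi> z / (\<Prod>y\<leftarrow>a # ys. z - y) - \<phi> z / (\<Prod>y\<leftarrow>b # ys. z - y)
        = (a - b) * (\<phi> z / (\<Prod>y\<leftarrow>a # b # ys. z - y))"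
      by (simp add: divide_simps) (simp add: algebra_simps)
  qed
  also have "\<dots> = (a - b) * contour_integral g (\<lambda>z. \<phi> z / (\<Prod>y\<leftarrow>a # b # ys. z - y))"
    by (rule contour_integral_lmul, rule int) auto
  finally show ?thesis unfolding ddc_def by (simp add: diff_divide_distrib[symmetric])
qed

text \<open>Newton interpolation with remainder, by iterating \<open>ddc_recurrence\<close>. The
  left side is winding number times value (\<open>ddc_single\<close>): with \<open>w\<close> inside
  a circle this is the usual interpolation formula, with \<open>w\<close> outside it expresses the
  remainder through the Newton polynomial.\<close>

lemma ddc_newton:
  assumes "\<phi> holomorphic_on UNIV" "valid_path g" "w \<notin> path_image g"
    and "\<And>i. i < n \<Longrightarrow> l i \<notin> path_image g"
  shows "ddc g \<phi> [w] = (\<Sum>m<n. ddc g \<phi> (map l [0..<Suc m]) * (\<Prod>i<m. w - l i))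
           + (\<Prod>i<n. w - l i) * ddc g \<phi> (w # map l [0..<n])"
  using assms(4)
proof (induction n)
  case (Suc n)
  have "(w - l n) * ddc g \<phi> (w # l n # map l [0..<n])
      = ddc g \<phi> (w # map l [0..<n]) - ddc g \<phi> (l n # map l [0..<n])"
    by (rule ddc_recurrence) (use assms Suc.prems in auto)
  also have "ddc g \<phi> (w # l n # map l [0..<n]) = ddc g \<phi> (w # map l [0..<Suc n])"
    by (rule ddc_perm) simp
  also have "ddc g \<phi> (l n # map l [0..<n]) = ddc g \<phi> (map l [0..<Suc n])"
    by (rule ddc_perm) simp
  finally have "ddc g \<phi> (w # map l [0..<n])
      = ddc g \<phi> (map l [0..<Suc n]) + (w - l n) * ddc g \<phi> (w # map l [0..<Suc n])"
    by simp
  then have "(\<Prod>i<n. w - l i) * ddc g \<phi> (w # map l [0..<n])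
      = ddc g \<phi> (map l [0..<Suc n]) * (\<Prod>i<n. w - l i)
        + (\<Prod>i<Suc n. w - l i) * ddc g \<phi> (w # map l [0..<Suc n])"
    by (simp add: ring_distribs mult_ac del: upt_Suc)
  then show ?case using Suc by (simp del: upt_Suc prod.lessThan_Suc)
qed simp

lemma ddc_single:
  assumes "\<phi> holomorphic_on UNIV" "valid_path g" "pathfinish g = pathstart g" "w \<notin> path_image g"
  shows "ddc g \<phi> [w] = winding_number g w * \<phi> w"
proof -
  have "residue (\<lambda>z. \<phi> z / (z - w)) w = \<phi> w"
    by (rule residue_simple[of UNIV]) (use assms in auto)
  then show ?thesis using ddc_eq_sum_residue[OF assms(1-3), of "[w]"] assms(4) by simp
qed

lemma uniform_limit_prod_list_diff:
  fixes S :: "complex set"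
  assumes "list_all2 (\<lambda>f y. (f \<longlongrightarrow> y) F) fs ys" and "compact S"
  shows "uniform_limit S (\<lambda>t z. \<Prod>f\<leftarrow>fs. z - f t) (\<lambda>z. \<Prod>y\<leftarrow>ys. z - y) F"
  using assms(1)
proof (induction rule: list_all2_induct)
  case (Cons f fs y ys)
  have bdd: "bounded (h ` S)" if "continuous_on S h" for h :: "complex \<Rightarrow> complex"
    using assms(2) that by (intro compact_imp_bounded compact_continuous_image)
  have 1: "uniform_limit S (\<lambda>t z. z - f t) (\<lambda>z. z - y) F"
    using Cons(1) by (auto simp: uniform_limit_iff tendsto_iff dist_norm norm_minus_commute)
  have "uniform_limit S (\<lambda>t z. (z - f t) * (\<Prod>f\<leftarrow>fs. z - f t))
     (\<lambda>z. (z - y) * (\<Prod>y\<leftarrow>ys. z - y)) F"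
    by (intro uniform_lim_mult 1 Cons.IH bdd holomorphic_on_imp_continuous_on holomorphic_intros)
  then show ?case by simp
qed (simp add: uniform_limit_const)

text \<open>On the fixed circle the integrands converge uniformly, since the limiting nodes stay
  away from it. Nodes may coalesce in the limit; the moving nodes are given as the list
  \<open>fs\<close> of functions of the parameter.\<close>

lemma tendsto_ddc:
  assumes \<phi>: "\<phi> holomorphic_on UNIV"
    and lim: "list_all2 (\<lambda>f y. (f \<longlongrightarrow> y) F) fs ys"
    and ys: "\<And>y. y \<in> set ys \<Longrightarrow> norm y < r" and "r > 0"
  shows "((\<lambda>t. ddc (circlepath 0 r) \<phi> (map (\<lambda>f. f t) fs)) \<longlongrightarrow> ddc (circlepath 0 r) \<phi> ys) F"
proof (cases "F = bot")
  case False
  let ?g = "circlepath 0 r"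
  have im: "path_image ?g = sphere 0 r" using \<open>r > 0\<close> by (simp add: path_image_circlepath_nonneg)
  have comp: "compact (path_image ?g)" by (simp add: compact_path_image)
  have cont: "continuous_on (path_image ?g) (\<lambda>z. \<Prod>y\<leftarrow>ys. z - y)"
    by (intro holomorphic_on_imp_continuous_on holomorphic_intros)
  have ne: "(\<Prod>y\<leftarrow>ys. z - y) \<noteq> 0" if "z \<in> path_image ?g" for z
    using that ys unfolding im by (force simp: prod_list_diff_eq_0_iff)
  \<comment> \<open>A positive lower bound for the limiting denominator, attained on the compact
    circle, makes the division uniform.\<close>
  obtain b where b: "b > 0" "\<And>z. z \<in> path_image ?g \<Longrightarrow> b \<le> norm (\<Prod>y\<leftarrow>ys. z - y)"
  proof -
    have "continuous_on (path_image ?g) (\<lambda>z. norm (\<Prod>y\<leftarrow>ys. z - y))"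
      using cont by (rule continuous_on_norm)
    from continuous_attains_inf[OF comp _ this] obtain z0 where z0: "z0 \<in> path_image ?g"
        "\<And>z. z \<in> path_image ?g \<Longrightarrow> norm (\<Prod>y\<leftarrow>ys. z0 - y) \<le> norm (\<Prod>y\<leftarrow>ys. z - y)"
      by (metis path_image_nonempty)
    show ?thesis by (rule that[of "norm (\<Prod>y\<leftarrow>ys. z0 - y)"]) (use z0 ne[OF z0(1)] in simp_all)
  qed
  have ul: "uniform_limit (path_image ?g) (\<lambda>t z. \<phi> z / (\<Prod>f\<leftarrow>fs. z - f t)) (\<lambda>z. \<phi> z / (\<Prod>y\<leftarrow>ys. z - y)) F"
    by (rule uniform_lim_divide[OF uniform_limit_const uniform_limit_prod_list_diff[OF lim comp] _ b(2) b(1)])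
       (intro compact_imp_bounded compact_continuous_image comp
          holomorphic_on_imp_continuous_on holomorphic_on_subset[OF \<phi>] subset_UNIV)
  have ev: "eventually (\<lambda>t. \<forall>f\<in>set fs. norm (f t) < r) F"
  proof (rule eventually_ball_finite, simp, rule ballI)
    fix f assume "f \<in> set fs"
    then obtain y where "y \<in> set ys" "(f \<longlongrightarrow> y) F"
      using lim unfolding list_all2_conv_all_nth by (metis in_set_conv_nth)
    then show "eventually (\<lambda>t. norm (f t) < r) F"
      using ys by (auto intro: order_tendstoD tendsto_norm)
  qed
  have "((\<lambda>t. contour_integral ?g (\<lambda>z. \<phi> z / (\<Prod>f\<leftarrow>fs. z - f t)))
      \<longlongrightarrow> contour_integral ?g (\<lambda>z. \<phi> z / (\<Prod>y\<leftarrow>ys. z - y))) F"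
  proof (rule contour_integral_uniform_limit_circlepath(2))
    show "\<forall>\<^sub>F t in F. (\<lambda>z. \<phi> z / (\<Prod>f\<leftarrow>fs. z - f t)) contour_integrable_on ?g"
      using ev
    proof eventually_elim
      case (elim t)
      have "(\<lambda>z. \<phi> z / (\<Prod>y\<leftarrow>map (\<lambda>f. f t) fs. z - y)) contour_integrable_on ?g"
        using elim by (intro ddc_integrable \<phi>) (simp, unfold im, force)
      then show ?case by (simp add: o_def)
    qed
  qed (use ul[unfolded im] False \<open>r > 0\<close> in simp_all)
  then show ?thesis
    unfolding ddc_def by (intro tendsto_divide tendsto_const) (simp_all add: o_def)
qed simp

section \<open>Explicit divided differences at distinct nodes\<close>

lemma DD_insert_zeros:
  assumes "finite X" "u \<notin> X" "\<And>x. x \<in> X \<Longrightarrow> \<psi> x = 0"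
  shows "DD \<psi> (insert u X) = \<psi> u / (\<Prod>x\<in>X. u - x)"
  unfolding DD_def using assms by (simp add: insert_Diff_if)

lemma DD_linear:
  "DD (\<lambda>z. f z - (\<Sum>m\<in>M. c m * h m z)) Y = DD f Y - (\<Sum>m\<in>M. c m * DD (h m) Y)"
proof -
  have "(\<Sum>m\<in>M. c m * DD (h m) Y)
      = (\<Sum>y\<in>Y. (\<Sum>m\<in>M. c m * h m y) / (\<Prod>y'\<in>Y - {y}. y - y'))"
    unfolding DD_def sum_distrib_left sum_divide_distrib
    by (subst sum.swap) (simp add: mult_ac)
  then show ?thesis
    by (simp add: DD_def diff_divide_distrib sum_subtractf)
qed

text \<open>The function e^{p(z-v)}/(z-v) is not entire, so the facts on \<open>ddc\<close> do not
  cover it. Dividing by z - v amounts to adding the node v, up to the summand at v itself, which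
  leads back to an entire function.\<close>

lemma DD_divide_linear:
  assumes "finite Y" "v \<notin> Y"
  shows "DD (\<lambda>z. \<phi> z / (z - v)) Y = DD \<phi> (insert v Y) - \<phi> v / (\<Prod>y\<in>Y. v - y)"
proof -
  have "\<phi> y / (y - v) / (\<Prod>y'\<in>Y - {y}. y - y') = \<phi> y / (\<Prod>y'\<in>insert v Y - {y}. y - y')"
    if "y \<in> Y" for y
  proof -
    have "insert v Y - {y} = insert v (Y - {y})" using that assms by auto
    then show ?thesis using assms by simp
  qed
  then have "(\<Sum>y\<in>Y. \<phi> y / (y - v) / (\<Prod>y'\<in>Y - {y}. y - y'))
      = (\<Sum>y\<in>Y. \<phi> y / (\<Prod>y'\<in>insert v Y - {y}. y - y'))"
    by (rule sum.cong[OF refl])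
  then show ?thesis unfolding DD_def using assms by simp
qed

text \<open>By induction the values at the earlier nodes vanish, which leaves one summand of the
  divided difference, with nonzero denominator. Interpolation at the nodes can thus be imposed
  through divided differences over initial segments.\<close>

lemma zero_if_DD_zero:
  assumes "inj_on x {..<n}" and "\<And>i. i < n \<Longrightarrow> DD \<psi> (x ` {..i}) = 0" and "i < n"
  shows "\<psi> (x (i::nat)) = 0"
  using assms(3)
proof (induction i rule: less_induct)
  case (less i)
  have ni: "x i \<notin> x ` {..<i}"
    using assms(1) less.prems by (fastforce simp: inj_on_def)
  have "x ` {..i} = insert (x i) (x ` {..<i})"
    by (auto simp: lessThan_Suc_atMost[symmetric] lessThan_Suc)
  moreover have "DD \<psi> (insert (x i) (x ` {..<i})) = \<psi> (x i) / (\<Prod>y\<in>x ` {..<i}. x i - y)"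
    using less.IH less.prems ni by (intro DD_insert_zeros) auto
  ultimately have "0 = \<psi> (x i) / (\<Prod>y\<in>x ` {..<i}. x i - y)"
    using assms(2)[OF less.prems] by simp
  moreover have "(\<Prod>y\<in>x ` {..<i}. x i - y) \<noteq> 0" using ni by auto
  ultimately show ?case by simp
qed

section \<open>Interpolation by exponentials\<close>

abbreviation dde :: "real \<Rightarrow> complex \<Rightarrow> complex list \<Rightarrow> complex" where
  "dde r c \<equiv> ddc (circlepath 0 r) (\<lambda>z. exp (z * c))"

text \<open>Divided differences at \<open>x\<^sub>0, \<dots>, x\<^sub>i\<close> of the exponential with exponent \<open>l\<^sub>m\<close>, and of
  \<open>e\<^bsup>p(z-v)\<^esup>/(z-v)\<close> times the factor \<open>\<Prod>(v - x\<^sub>a)\<close> that removes the pole as a node approaches \<open>v\<close>.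
  The quotient \<open>B\<^sub>l\<^sub>,\<^sub>p(u,x/v)/B\<^sub>l(x)\<close> for one pair \<open>u, v\<close> is \<open>ratio1\<close>.\<close>

definition dd_mat :: "real \<Rightarrow> (nat \<Rightarrow> complex) \<Rightarrow> (nat \<Rightarrow> complex) \<Rightarrow> nat \<Rightarrow> nat \<Rightarrow> complex" where
  "dd_mat r l x i m = dde r (l m) (map x [0..<Suc i])"

definition dd_rhs :: "real \<Rightarrow> nat \<Rightarrow> complex \<Rightarrow> (nat \<Rightarrow> complex) \<Rightarrow> complex \<Rightarrow> nat \<Rightarrow> complex" where
  "dd_rhs r n p x v i = (\<Prod>a<n. v - x a) * exp (- p * v) * dde r p (map x [0..<Suc i] @ [v])
     - (\<Prod>a\<in>{i<..<n}. v - x a)"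

definition ratio1 :: "real \<Rightarrow> nat \<Rightarrow> complex \<Rightarrow> (nat \<Rightarrow> complex) \<Rightarrow> complex \<Rightarrow> (nat \<Rightarrow> complex) \<Rightarrow> complex \<Rightarrow> complex"
  where "ratio1 r n p l u x v = 1
     + (u - v) * ((\<Prod>a<n. v - x a) * exp (- p * v) * dde r p (map x [0..<n] @ [u, v]))
     - (u - v) * (\<Sum>m<n. cramer n (dd_mat r l x) (dd_rhs r n p x v) m * dde r (l m) (map x [0..<n] @ [u]))"

lemma dde_distinct:
  assumes "\<And>y. y \<in> set ys \<Longrightarrow> norm y < r" and "distinct ys"
  shows "dde r c ys = DD (\<lambda>z. exp (z * c)) (set ys)"
proof (cases "ys = []")
  case False
  then have "r > 0" using assms(1)[of "hd ys"] by (auto intro: le_less_trans[OF norm_ge_zero])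
  then have "y \<notin> path_image (circlepath 0 r) \<and> winding_number (circlepath 0 r) y = 1"
    if "y \<in> set ys" for y
    using assms(1)[OF that] by (auto simp: path_image_circlepath_nonneg winding_number_circlepath)
  then show ?thesis
    using assms(2) by (intro ddc_distinct) (auto intro!: holomorphic_intros)
next
  case True
  \<comment> \<open>For the empty list nothing forces \<open>r\<close> to be positive; the entire
    integrand has integral 0 over the closed path, and the sum over the empty set is 0.\<close>
  have "((\<lambda>z. exp (z * c)) has_contour_integral 0) (circlepath 0 r)"
    by (rule Cauchy_theorem_convex_simple[of _ UNIV]) (auto intro!: holomorphic_intros)
  then show ?thesis
    using True by (simp add: ddc_def DD_def contour_integral_unique)
qed

section \<open>The determinants expressed by divided differences\<close>

lemma prod_lessThan_add:
  fixes f :: "nat \<Rightarrow> 'a::comm_monoid_mult"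
  shows "(\<Prod>i<k + n. f i) = (\<Prod>i<k. f i) * (\<Prod>i<n. f (k + i))"
  by (induction n) (auto simp: mult_ac)

lemma prod_pairs_less:
  fixes f :: "nat \<Rightarrow> nat \<Rightarrow> 'a::comm_monoid_mult"
  shows "(\<Prod>(i,j) \<in> {(i,j). i < j \<and> j < n}. f i j) = (\<Prod>j<n. \<Prod>i<j. f i j)"
proof -
  have "(\<Prod>j<n. \<Prod>i<j. f i j) = (\<Prod>(j,i)\<in>Sigma {..<n} (\<lambda>j. {..<j}). f i j)"
    by (rule prod.Sigma) auto
  also have "\<dots> = (\<Prod>(i,j) \<in> {(i,j). i < j \<and> j < n}. f i j)"
    by (rule prod.reindex_bij_witness[where i = prod.swap and j = prod.swap]) auto
  finally show ?thesis ..
qed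

text \<open>Passing from values at the nodes to divided differences over initial segments is a lower
  triangular row operation \<open>T\<close>, whose determinant is the reciprocal Vandermonde product
  up to sign. The right side stays meaningful and continuous when nodes coincide.\<close>

lemma B_raw_eq_dd_mat:
  assumes inj: "inj_on x {..<n}" and r: "\<And>a. a < n \<Longrightarrow> norm (x a) < r"
  shows "B_raw n l x = (\<Prod>j<n. (-1) ^ j) * detn n (dd_mat r (\<lambda>m. of_real (l m)) x)"
proof -
  define T where "T i a = (if a \<le> i then 1 / (\<Prod>y\<in>x ` {..i} - {x a}. x a - y) else 0)" for i a
  have mat: "dd_mat r (\<lambda>m. of_real (l m)) x i m = (\<Sum>a<n. T i a * exp (x a * of_real (l m)))"
    if i: "i < n" for i m
  proof -
    have inj': "inj_on x {..i}" by (rule inj_on_subset[OF inj]) (use i in auto)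
    have s: "set (map x [0..<Suc i]) = x ` {..i}" by (simp add: atLeastLessThanSuc_atLeastAtMost atLeast0AtMost del: upt_Suc)
    have "dd_mat r (\<lambda>m. of_real (l m)) x i m = DD (\<lambda>z. exp (z * of_real (l m))) (set (map x [0..<Suc i]))"
      unfolding dd_mat_def
      by (rule dde_distinct) (use i r inj' in \<open>auto simp: distinct_map atLeastLessThanSuc_atLeastAtMost atLeast0AtMost simp del: upt_Suc\<close>)
    also have "\<dots> = (\<Sum>a\<le>i. exp (x a * of_real (l m)) / (\<Prod>y\<in>x ` {..i} - {x a}. x a - y))"
      unfolding s DD_def using inj' by (simp add: sum.reindex)
    also have "\<dots> = (\<Sum>a<n. T i a * exp (x a * of_real (l m)))"
      by (rule sum.mono_neutral_cong_left) (use i in \<open>auto simp: T_def\<close>)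
    finally show ?thesis .
  qed
  have "detn n (dd_mat r (\<lambda>m. of_real (l m)) x)
      = detn n (\<lambda>i m. \<Sum>a<n. T i a * exp (x a * of_real (l m)))"
    by (rule detn_cong) (simp add: mat)
  also have "\<dots> = detn n T * detn n (\<lambda>i j. exp (x i * of_real (l j)))"
    by (rule detn_mult)
  also have "detn n T = (\<Prod>i<n. T i i)"
    by (rule detn_lower_triangular) (auto simp: T_def)
  also have "\<dots> = (\<Prod>i<n. \<Prod>a<i. 1 / (x i - x a))"
  proof (rule prod.cong[OF refl])
    fix i assume i: "i \<in> {..<n}"
    have inj': "inj_on x {..i}" by (rule inj_on_subset[OF inj]) (use i in auto)
    have "x ` {..i} - {x i} = x ` ({..i} - {i})"
      using inj' by (auto simp: inj_on_def)
    also have "{..i} - {i} = {..<i}" by auto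
    finally have "T i i = 1 / (\<Prod>y\<in>x ` {..<i}. x i - y)" by (simp add: T_def)
    also have "\<dots> = 1 / (\<Prod>a<i. x i - x a)"
      by (subst prod.reindex) (auto intro: inj_on_subset[OF inj'])
    finally show "T i i = (\<Prod>a<i. 1 / (x i - x a))" by (simp add: prod_dividef)
  qed
  also have "\<dots> = (\<Prod>j<n. (-1) ^ j) / (\<Prod>j<n. \<Prod>i<j. x i - x j)"
  proof -
    \<comment> \<open>The differences in \<open>B_raw\<close> have the opposite orientation, which
      costs one sign for each pair.\<close>
    have "(\<Prod>a<i. 1 / (x i - x a)) = (-1) ^ i / (\<Prod>a<i. x a - x i)" for i
    proof -
      have "(\<Prod>a<i. 1 / (x i - x a)) = (\<Prod>a<i. (-1) / (x a - x i))"
        by (rule prod.cong) (metis minus_diff_eq minus_divide_divide)+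
      also have "\<dots> = (-1) ^ i / (\<Prod>a<i. x a - x i)" by (subst prod_dividef) simp
      finally show ?thesis .
    qed
    then show ?thesis by (simp add: prod_dividef)
  qed
  finally have "detn n (dd_mat r (\<lambda>m. of_real (l m)) x) = (\<Prod>j<n. (-1) ^ j) * B_raw n l x"
    by (simp add: B_raw_def prod_pairs_less)
  moreover have "(\<Prod>j<n. (-1) ^ j) * (\<Prod>j<n. (-1) ^ j) = (1::complex)"
    by (simp flip: prod.distrib power_mult_distrib)
  ultimately show ?thesis by (simp flip: mult.assoc)
qed

lemma DD_cmult: "DD (\<lambda>z. c * \<phi> z) Y = c * DD \<phi> Y"
  by (simp add: DD_def sum_distrib_left)

text \<open>The error \<open>\<psi>\<close> of the interpolation has vanishing divided differences
  over initial segments of the nodes, by Cramer's rule, and so vanishes at the nodes. Its divided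
  difference over the nodes and \<open>u\<close> is then known in two ways: as a multiple of
  \<open>\<psi> u\<close>, and by linearity as a multiple of \<open>ratio1\<close>.\<close>

lemma interpolation_error:
  fixes l x :: "nat \<Rightarrow> complex" and p :: complex
  assumes inj: "inj_on x {..<n}" and r: "\<And>a. a < n \<Longrightarrow> norm (x a) < r" "norm u < r" "norm v < r"
    and ne: "\<And>a. a < n \<Longrightarrow> u \<noteq> x a" "\<And>a. a < n \<Longrightarrow> v \<noteq> x a" "u \<noteq> v"
    and d: "detn n (dd_mat r l x) \<noteq> 0"
  defines "c \<equiv> \<lambda>m. cramer n (dd_mat r l x) (dd_rhs r n p x v) m / (\<Prod>a<n. v - x a)"
  shows "\<And>a. a < n \<Longrightarrow> (\<Sum>m<n. exp (x a * l m) * c m) = exp (p * (x a - v)) / (x a - v)"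
    and "exp (p * (u - v)) / (u - v) - (\<Sum>m<n. exp (u * l m) * c m)
       = (\<Prod>a<n. u - x a) * (1 / (\<Prod>a<n. v - x a)) * (1 / (u - v) * ratio1 r n p l u x v)"
proof -
  define P where "P = (\<Prod>a<n. v - x a)"
  have P: "P \<noteq> 0" using ne by (auto simp: P_def)
  define \<psi> where "\<psi> z = exp (- p * v) * exp (z * p) / (z - v) - (\<Sum>m<n. c m * exp (z * l m))" for z
  \<comment> \<open>Multiplying by \<open>P\<close> turns the coefficients \<open>c\<close> into
    Cramer quotients without the denominators v - x_a.\<close>
  have DD_psi: "P * DD \<psi> Y = P * exp (- p * v) * DD (\<lambda>z. exp (z * p)) (insert v Y)
      - P / (\<Prod>y\<in>Y. v - y)
      - (\<Sum>m<n. cramer n (dd_mat r l x) (dd_rhs r n p x v) m * DD (\<lambda>z. exp (z * l m)) Y)"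
    if "finite Y" "v \<notin> Y" for Y
  proof -
    have "DD \<psi> Y = exp (- p * v) * DD (\<lambda>z. exp (z * p)) (insert v Y)
      - (exp (- p * v) * exp (v * p)) / (\<Prod>y\<in>Y. v - y) - (\<Sum>m<n. c m * DD (\<lambda>z. exp (z * l m)) Y)"
      unfolding \<psi>_def DD_linear by (subst DD_divide_linear[OF that]) (simp add: DD_cmult)
    moreover have "exp (- p * v) * exp (v * p) = 1" by (simp flip: exp_add)
    moreover have "P * (\<Sum>m<n. c m * DD (\<lambda>z. exp (z * l m)) Y)
       = (\<Sum>m<n. cramer n (dd_mat r l x) (dd_rhs r n p x v) m * DD (\<lambda>z. exp (z * l m)) Y)"
      unfolding sum_distrib_left using P by (intro sum.cong) (auto simp: c_def P_def)
    ultimately show ?thesis by (simp add: right_diff_distrib mult.assoc)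
  qed
  have zero: "\<psi> (x i) = 0" if "i < n" for i
  proof (rule zero_if_DD_zero[OF inj _ that])
    fix i assume i: "i < n"
    have inj': "inj_on x {..i}" by (rule inj_on_subset[OF inj]) (use i in auto)
    have s: "set (map x [0..<Suc i]) = x ` {..i}" by (simp add: atLeastLessThanSuc_atLeastAtMost atLeast0AtMost del: upt_Suc)
    have ds: "distinct (map x [0..<Suc i])"
      using inj' by (simp add: distinct_map atLeastLessThanSuc_atLeastAtMost atLeast0AtMost del: upt_Suc)
    have nv: "v \<notin> x ` {..i}" using ne(2) i by (metis atMost_iff imageE le_less_trans)
    have 1: "DD (\<lambda>z. exp (z * l m)) (x ` {..i}) = dd_mat r l x i m" for m
      unfolding dd_mat_def s[symmetric] by (rule dde_distinct[symmetric])
        (use i r ds in \<open>auto simp: s simp del: upt_Suc\<close>)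
    have 2: "DD (\<lambda>z. exp (z * p)) (insert v (x ` {..i})) = dde r p (map x [0..<Suc i] @ [v])"
    proof -
      have "insert v (x ` {..i}) = set (map x [0..<Suc i] @ [v])" using s by auto
      then show ?thesis using i r ds nv
        by (simp only:, intro dde_distinct[symmetric]) (auto simp: s simp del: upt_Suc)
    qed
    \<comment> \<open>The factors of \<open>P\<close> with index at most \<open>i\<close> cancel;
      the remaining ones are the second term of \<open>dd_rhs\<close>.\<close>
    have 3: "P / (\<Prod>y\<in>x ` {..i}. v - y) = (\<Prod>a\<in>{i<..<n}. v - x a)"
    proof -
      have split: "{..<n} = {..i} \<union> {i<..<n}" using i by auto
      have "P = (\<Prod>a\<in>{..i}. v - x a) * (\<Prod>a\<in>{i<..<n}. v - x a)"
        unfolding P_def by (subst split, rule prod.union_disjoint) auto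
      moreover have "(\<Prod>y\<in>x ` {..i}. v - y) = (\<Prod>a\<in>{..i}. v - x a)"
        using inj' by (simp add: prod.reindex)
      moreover have "(\<Prod>a\<in>{..i}. v - x a) \<noteq> 0" using nv by auto
      ultimately show ?thesis by simp
    qed
    have "P * DD \<psi> (x ` {..i}) = dd_rhs r n p x v i
       - (\<Sum>m<n. dd_mat r l x i m * cramer n (dd_mat r l x) (dd_rhs r n p x v) m)"
      unfolding DD_psi[OF finite_imageI[OF finite_atMost] nv] 1 2 3
      by (simp add: dd_rhs_def P_def mult.commute del: upt_Suc)
    then show "DD \<psi> (x ` {..i}) = 0"
      using P cramer_solves[OF d i] by simp
  qed
  show "(\<Sum>m<n. exp (x a * l m) * c m) = exp (p * (x a - v)) / (x a - v)" if "a < n" for a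
    using zero[OF that] by (simp add: \<psi>_def exp_diff exp_minus mult_ac right_diff_distrib field_simps)
  have "DD \<psi> (insert u (x ` {..<n})) = \<psi> u / (\<Prod>y\<in>x ` {..<n}. u - y)"
    by (rule DD_insert_zeros) (use ne zero in \<open>auto simp: image_iff\<close>)
  also have "(\<Prod>y\<in>x ` {..<n}. u - y) = (\<Prod>a<n. u - x a)"
    using inj by (simp add: prod.reindex)
  finally have "P * DD \<psi> (insert u (x ` {..<n})) * (\<Prod>a<n. u - x a) = P * \<psi> u"
    using ne by simp
  \<comment> \<open>Evaluation by linearity. The summand at \<open>v\<close> contributes - 1 / (v -
    u), which is the leading 1 of \<open>ratio1\<close> after multiplication by u - v.\<close>
  moreover have "P * DD \<psi> (insert u (x ` {..<n})) = 1 / (u - v) * ratio1 r n p l u x v"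
  proof -
    have s: "set (map x [0..<n]) = x ` {..<n}" by (auto simp: atLeast0LessThan)
    have nuv: "u \<notin> x ` {..<n}" "v \<notin> x ` {..<n}"
      using ne(1,2) by (metis imageE lessThan_iff)+
    have ds: "distinct (map x [0..<n])"
      using inj by (simp add: distinct_map atLeast0LessThan)
    have 1: "DD (\<lambda>z. exp (z * l m)) (insert u (x ` {..<n})) = dde r (l m) (map x [0..<n] @ [u])" for m
    proof -
      have "insert u (x ` {..<n}) = set (map x [0..<n] @ [u])" using s by auto
      then show ?thesis using r ds nuv ne(3)
        by (simp only:, intro dde_distinct[symmetric]) (auto simp: s)
    qed
    have 2: "DD (\<lambda>z. exp (z * p)) (insert v (insert u (x ` {..<n}))) = dde r p (map x [0..<n] @ [u, v])"
    proof -
      have "insert v (insert u (x ` {..<n})) = set (map x [0..<n] @ [u, v])" using s by auto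
      then show ?thesis using r ds nuv ne(3)
        by (simp only:, intro dde_distinct[symmetric]) (auto simp: s)
    qed
    have 3: "(\<Prod>y\<in>insert u (x ` {..<n}). v - y) = (v - u) * P"
      unfolding P_def using nuv by (subst prod.insert) (auto simp: prod.reindex[OF inj])
    have "P * DD \<psi> (insert u (x ` {..<n})) = P * exp (- p * v) * dde r p (map x [0..<n] @ [u, v])
       - 1 / (v - u)
       - (\<Sum>m<n. cramer n (dd_mat r l x) (dd_rhs r n p x v) m * dde r (l m) (map x [0..<n] @ [u]))"
      by (subst DD_psi) (use nuv ne(3) P in \<open>auto simp: 1 2 3\<close>)
    then show ?thesis
      using ne(3) unfolding ratio1_def P_def[symmetric]
      by (simp add: field_simps)
  qed
  moreover have "\<psi> u = exp (p * (u - v)) / (u - v) - (\<Sum>m<n. exp (u * l m) * c m)"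
    by (simp add: \<psi>_def right_diff_distrib exp_diff exp_minus mult_ac field_simps)
  moreover have "y = c * (1 / P) * z" if "z * c = P * y" for c y z
    using that P by (simp add: field_simps)
  ultimately show "exp (p * (u - v)) / (u - v) - (\<Sum>m<n. exp (u * l m) * c m)
       = (\<Prod>a<n. u - x a) * (1 / (\<Prod>a<n. v - x a)) * (1 / (u - v) * ratio1 r n p l u x v)"
    unfolding P_def[symmetric] by metis
qed

text \<open>The last \<open>n\<close> arguments serve as nodes. \<open>detn_bordered\<close> reduces
  the determinant to interpolation errors, \<open>interpolation_error\<close> turns these into
  \<open>ratio1\<close> times row and column factors, and those factors cancel against the mixed
  products of differences.\<close>

lemma Bp_raw_factorization:
  fixes U V :: "nat \<Rightarrow> complex" and l :: "nat \<Rightarrow> real"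
  assumes g: "generic_uv n k (U, V)"
    and r: "\<And>i. i < n + k \<Longrightarrow> norm (U i) < r" "\<And>j. j < k \<Longrightarrow> norm (V j) < r"
  defines "x \<equiv> \<lambda>a. U (k + a)" and "L \<equiv> \<lambda>m. of_real (l m)"
  assumes d: "detn n (dd_mat r L x) \<noteq> 0"
  shows "Bp_raw n k l p (U, V) = B_raw n l x *
     ((\<Prod>i<k. \<Prod>j<k. (U i - V j))
        / (\<Prod>(i,j) \<in> {(i,j). i < j \<and> j < k}. (U i - U j) * (V j - V i))
      * detn k (\<lambda>i j. 1 / (U i - V j) * ratio1 r n p L (U i) x (V j)))"
proof -
  have inj: "inj_on U {..<n + k}" and injV: "inj_on V {..<k}"
    and UV: "\<And>i j. i < n + k \<Longrightarrow> j < k \<Longrightarrow> U i \<noteq> V j"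
    using g by (auto simp: generic_uv_def distinct_upto_def)
  have injx: "inj_on x {..<n}"
    using inj_onD[OF inj, of "k + _" "k + _"] by (intro inj_onI) (auto simp: x_def)
  have rx: "norm (x a) < r" if "a < n" for a using r(1)[of "k + a"] that by (simp add: x_def)
  have ux: "U i \<noteq> x a" if "i < k" "a < n" for i a
    using inj_onD[OF inj, of i "k + a"] that by (auto simp: x_def)
  have vx: "V j \<noteq> x a" if "j < k" "a < n" for j a
    using UV[of "k + a" j] that by (auto simp: x_def)
  have UVne: "U i \<noteq> V j" if "i < k" "j < k" for i j using UV[of i j] that by simp
  define c where "c m j = cramer n (dd_mat r L x) (dd_rhs r n p x (V j)) m / (\<Prod>a<n. V j - x a)" for m j
  define PUX where "PUX = (\<Prod>i<k. \<Prod>a<n. U i - x a)"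
  define PVX where "PVX = (\<Prod>j<k. \<Prod>a<n. V j - x a)"
  define PU where "PU = (\<Prod>i<k. \<Prod>j<k. (U i - V j))"
  define VU where "VU = (\<Prod>j<k. \<Prod>i<j. U i - U j)"
  define VV where "VV = (\<Prod>j<k. \<Prod>i<j. V j - V i)"
  define VX where "VX = (\<Prod>j<n. \<Prod>i<j. x i - x j)"
  define E where "E = detn n (\<lambda>i j. exp (x i * L j))"
  define Q where "Q = detn k (\<lambda>i j. 1 / (U i - V j) * ratio1 r n p L (U i) x (V j))"
  have nz: "PUX \<noteq> 0" "PVX \<noteq> 0"
    using ux vx by (auto simp: PUX_def PVX_def)
  have "detn (n + k) (\<lambda>i j. if j < k then exp (p * (U i - V j)) / (U i - V j)
                            else exp (U i * of_real (l (j - k))))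
     = detn (n + k) (\<lambda>i j. if j < k then exp (p * (U i - V j)) / (U i - V j)
          else if i < k then exp (U i * L (j - k)) else exp (x (i - k) * L (j - k)))"
    by (rule detn_cong) (auto simp: L_def x_def)
  also have "\<dots> = E * detn k (\<lambda>i j. exp (p * (U i - V j)) / (U i - V j)
                              - (\<Sum>m<n. exp (U i * L m) * c m j))"
    unfolding E_def
  proof (rule detn_bordered)
    fix a j assume aj: "a < n" "j < k"
    have "(\<Sum>m<n. exp (x a * L m) * c m j) = exp (p * (x a - V j)) / (x a - V j)"
      unfolding c_def
      \<comment> \<open>The interpolation identity does not mention \<open>u\<close>;
        \<open>U j\<close> is an admissible choice for it.\<close>
      by (rule interpolation_error(1)[where u = "U j"])
         (use injx rx r aj ux vx UVne d in auto)
    then show "(\<Sum>m<n. exp (x a * L m) * c m j) = exp (p * (U (k + a) - V j)) / (U (k + a) - V j)"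
      by (simp add: x_def)
  qed
  also have "detn k (\<lambda>i j. exp (p * (U i - V j)) / (U i - V j) - (\<Sum>m<n. exp (U i * L m) * c m j))
     = detn k (\<lambda>i j. (\<Prod>a<n. U i - x a) * (1 / (\<Prod>a<n. V j - x a))
                      * (1 / (U i - V j) * ratio1 r n p L (U i) x (V j)))"
    unfolding c_def
    by (intro detn_cong interpolation_error(2)) (use injx rx r ux vx UVne d in auto)
  also have "\<dots> = PUX * (1 / PVX) * Q"
    unfolding PUX_def PVX_def Q_def by (subst detn_scale) (simp add: prod_dividef)
  finally have det: "detn (n + k) (\<lambda>i j. if j < k then exp (p * (U i - V j)) / (U i - V j)
       else exp (U i * of_real (l (j - k)))) = E * (PUX * (1 / PVX) * Q)" .
  \<comment> \<open>Reversing the differences between nodes and \<open>V\<close> produces exactly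
    the sign in front of \<open>Bp_raw\<close>.\<close>
  have num: "(\<Prod>i<n + k. \<Prod>j<k. U i - V j) = PU * ((-1) ^ (n * k) * PVX)"
  proof -
    have "(\<Prod>i<n + k. \<Prod>j<k. U i - V j) = PU * (\<Prod>a<n. \<Prod>j<k. x a - V j)"
      by (subst add.commute) (simp add: prod_lessThan_add PU_def x_def)
    also have "(\<Prod>a<n. \<Prod>j<k. x a - V j) = (\<Prod>a<n. \<Prod>j<k. (-1) * (V j - x a))" by simp
    also have "\<dots> = (-1) ^ (n * k) * (\<Prod>a<n. \<Prod>j<k. V j - x a)"
      unfolding prod.distrib by (simp add: power_mult[symmetric] mult.commute)
    also have "(\<Prod>a<n. \<Prod>j<k. V j - x a) = PVX" unfolding PVX_def by (rule prod.swap)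
    finally show ?thesis .
  qed
  \<comment> \<open>The pairs split into those among the first \<open>k\<close> arguments, the mixed
    ones, and those among the nodes.\<close>
  have den: "(\<Prod>(i,j) \<in> {(i,j). i < j \<and> j < n + k}. U i - U j) = VU * (PUX * VX)"
  proof -
    have "(\<Prod>j<n + k. \<Prod>i<j. U i - U j) = VU * (\<Prod>b<n. (\<Prod>i<k. U i - x b) * (\<Prod>a<b. x a - x b))"
      by (subst add.commute) (simp add: prod_lessThan_add VU_def x_def)
    also have "\<dots> = VU * ((\<Prod>b<n. \<Prod>i<k. U i - x b) * VX)"
      by (simp add: prod.distrib VX_def)
    also have "(\<Prod>b<n. \<Prod>i<k. U i - x b) = PUX" unfolding PUX_def by (rule prod.swap)
    finally show ?thesis by (simp add: prod_pairs_less)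
  qed
  have sgn: "(-1) ^ (n * k) * ((-1) ^ (n * k) * y) = y" for y :: complex
    by (simp flip: power_mult_distrib mult.assoc)
  have "Bp_raw n k l p (U, V) = (-1) ^ (n * k) * (PU * ((-1) ^ (n * k) * PVX)) / (VU * (PUX * VX) * VV)
      * (E * (PUX * (1 / PVX) * Q))"
    unfolding Bp_raw_def Let_def fst_conv snd_conv num den det
    by (simp add: prod_pairs_less VV_def)
  also have "\<dots> = (PU * PVX) / (VU * (PUX * VX) * VV) * (E * (PUX * (1 / PVX) * Q))"
    by (simp add: sgn mult.left_commute[of PU])
  also have "\<dots> = E / VX * (PU / (VU * VV) * Q)"
    using nz by (simp add: field_simps)
  also have "E / VX = B_raw n l x"
    by (simp add: B_raw_def E_def VX_def L_def prod_pairs_less)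
  also have "VU * VV = (\<Prod>(i,j) \<in> {(i,j). i < j \<and> j < k}. (U i - U j) * (V j - V i))"
    by (simp add: prod_pairs_less VU_def VV_def prod.distrib)
  finally show ?thesis by (simp add: PU_def Q_def)
qed

section \<open>Continuity in the nodes\<close>

lemma tendsto_dde:
  assumes "list_all2 (\<lambda>f y. (f \<longlongrightarrow> y) F) fs ys"
    and "\<And>y. y \<in> set ys \<Longrightarrow> norm y < r" and "r > 0"
  shows "((\<lambda>t. dde r c (map (\<lambda>f. f t) fs)) \<longlongrightarrow> dde r c ys) F"
  by (rule tendsto_ddc) (use assms in \<open>auto intro!: holomorphic_intros\<close>)

lemma tendsto_dde_nodes:
  assumes "\<And>a. a < n \<Longrightarrow> ((\<lambda>t. x t a) \<longlongrightarrow> x0 a) F" "\<And>a. a < n \<Longrightarrow> norm (x0 a) < r"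
    and "list_all2 (\<lambda>f y. (f \<longlongrightarrow> y) F) fs ys"
    and "\<And>y. y \<in> set ys \<Longrightarrow> norm y < r" and "r > 0"
  shows "((\<lambda>t. dde r c (map (x t) [0..<n] @ map (\<lambda>f. f t) fs)) \<longlongrightarrow> dde r c (map x0 [0..<n] @ ys)) F"
proof -
  have "list_all2 (\<lambda>f y. (f \<longlongrightarrow> y) F) (map (\<lambda>a t. x t a) [0..<n]) (map x0 [0..<n])"
    using assms(1) by (simp add: list_all2_conv_all_nth)
  then have "((\<lambda>t. dde r c (map (\<lambda>f. f t) (map (\<lambda>a t. x t a) [0..<n] @ fs))) \<longlongrightarrow> dde r c (map x0 [0..<n] @ ys)) F"
    by (intro tendsto_dde list_all2_appendI) (use assms in auto)
  then show ?thesis by (simp add: o_def)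
qed

lemma tendsto_dd_mat:
  assumes "\<And>a. a < n \<Longrightarrow> ((\<lambda>t. x t a) \<longlongrightarrow> x0 a) F" "\<And>a. a < n \<Longrightarrow> norm (x0 a) < r" "i < n" "r > 0"
  shows "((\<lambda>t. dd_mat r l (x t) i m) \<longlongrightarrow> dd_mat r l x0 i m) F"
  unfolding dd_mat_def
  using tendsto_dde_nodes[of "Suc i" x x0 F r "[]" "[]"] assms by (simp del: upt_Suc)

text \<open>The only denominator that varies in \<open>ratio1\<close> is the determinant in
  \<open>cramer\<close>. Arguments may therefore coincide in the limit, and a node may tend to
  \<open>v0\<close>.\<close>

lemma tendsto_ratio1:
  assumes u: "(u \<longlongrightarrow> u0) F" "norm u0 < r" and v: "(v \<longlongrightarrow> v0) F" "norm v0 < r"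
    and x: "\<And>a. a < n \<Longrightarrow> ((\<lambda>t. x t a) \<longlongrightarrow> x0 a) F" "\<And>a. a < n \<Longrightarrow> norm (x0 a) < r"
    and d: "detn n (dd_mat r l x0) \<noteq> 0"
  shows "((\<lambda>t. ratio1 r n p l (u t) (x t) (v t)) \<longlongrightarrow> ratio1 r n p l u0 x0 v0) F"
proof -
  have r: "r > 0" using u(2) by (auto intro: le_less_trans[OF norm_ge_zero])
  have 1: "((\<lambda>t. dde r c (map (x t) [0..<n] @ [u t])) \<longlongrightarrow> dde r c (map x0 [0..<n] @ [u0])) F" for c
    using tendsto_dde_nodes[of n x x0 F r "[u]" "[u0]"] x u r by simp
  have 2: "((\<lambda>t. dde r c (map (x t) [0..<n] @ [u t, v t])) \<longlongrightarrow> dde r c (map x0 [0..<n] @ [u0, v0])) F" for c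
    using tendsto_dde_nodes[of n x x0 F r "[u,v]" "[u0,v0]"] x u v r by auto
  have 3: "((\<lambda>t. dde r c (map (x t) [0..<Suc i] @ [v t])) \<longlongrightarrow> dde r c (map x0 [0..<Suc i] @ [v0])) F"
    if "i < n" for c i
    using tendsto_dde_nodes[of "Suc i" x x0 F r "[v]" "[v0]"] x v r that by (simp del: upt_Suc)
  have rhs: "((\<lambda>t. dd_rhs r n p (x t) (v t) i) \<longlongrightarrow> dd_rhs r n p x0 v0 i) F" if "i < n" for i
    unfolding dd_rhs_def using that
    by (intro tendsto_intros 3 x v) auto
  have cr: "((\<lambda>t. cramer n (dd_mat r l (x t)) (dd_rhs r n p (x t) (v t)) m)
      \<longlongrightarrow> cramer n (dd_mat r l x0) (dd_rhs r n p x0 v0) m) F" for m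
    unfolding cramer_def
    by (intro tendsto_divide tendsto_detn d) (auto intro!: rhs tendsto_dd_mat[of n] x r)
  show ?thesis unfolding ratio1_def
    by (intro tendsto_intros 1 2 cr u v x) auto
qed

section \<open>Divided differences with all nodes at the origin\<close>

lemma higher_deriv_exp_mult: "(deriv ^^ n) (\<lambda>z. exp (z * c)) = (\<lambda>z. c ^ n * exp (z * c :: complex))"
proof (induction n)
  case (Suc n)
  have "deriv (\<lambda>z. c ^ n * exp (z * c)) = (\<lambda>z. c ^ Suc n * exp (z * c))"
    by (intro ext DERIV_imp_deriv) (auto intro!: derivative_eq_intros)
  then show ?case by (simp add: Suc)
qed simp

text \<open>Cauchy's formula for higher derivatives: \<open>n + 1\<close> nodes at the origin give
  the \<open>n\<close>-th Taylor coefficient.\<close>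

lemma dde_zeros:
  assumes "r > 0"
  shows "dde r c (replicate (Suc n) 0) = c ^ n / fact n"
proof -
  have "((\<lambda>u. exp (u * c) / (u - 0) ^ Suc n) has_contour_integral
      2 * pi * \<i> / fact n * (deriv ^^ n) (\<lambda>z. exp (z * c)) 0) (circlepath 0 r)"
    by (rule Cauchy_has_contour_integral_higher_derivative_circlepath)
       (use assms in \<open>auto intro!: holomorphic_intros continuous_intros\<close>)
  then have "contour_integral (circlepath 0 r) (\<lambda>u. exp (u * c) / u ^ Suc n) = 2 * pi * \<i> / fact n * c ^ n"
    by (simp add: contour_integral_unique higher_deriv_exp_mult)
  moreover have "(\<Prod>y\<leftarrow>replicate (Suc n) 0. z - y) = z ^ Suc n" for z :: complex
    by (simp add: map_replicate_const)
  ultimately show ?thesis by (simp add: ddc_def field_simps)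
qed

text \<open>A Taylor remainder divided by v^n; each use of \<open>ddc_recurrence\<close> with the
  node 0 subtracts one more Taylor term.\<close>

lemma dde_zeros_insert:
  assumes "norm v < r" "v \<noteq> 0"
  shows "dde r c (replicate n 0 @ [v]) = (exp (v * c) - (\<Sum>j<n. (v * c) ^ j / fact j)) / v ^ n"
proof -
  have r: "r > 0" using assms(1) by (auto intro: le_less_trans[OF norm_ge_zero])
  have hol: "(\<lambda>z. exp (z * c)) holomorphic_on UNIV" by (intro holomorphic_intros)
  have "dde r c (v # replicate n 0) = (exp (v * c) - (\<Sum>j<n. (v * c) ^ j / fact j)) / v ^ n"
  proof (induction n)
    case 0
    have "dde r c [v] = winding_number (circlepath 0 r) v * exp (v * c)"
      by (rule ddc_single) (use hol assms r in \<open>auto simp: path_image_circlepath_nonneg\<close>)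
    then show ?case using assms r by (simp add: winding_number_circlepath)
  next
    case (Suc n)
    have "(v - 0) * dde r c (v # 0 # replicate n 0) = dde r c (v # replicate n 0) - dde r c (0 # replicate n 0)"
      by (rule ddc_recurrence) (use hol assms r in \<open>auto simp: path_image_circlepath_nonneg\<close>)
    also have "dde r c (0 # replicate n 0) = c ^ n / fact n"
      using dde_zeros[OF r, of c n] by simp
    finally have "v * dde r c (v # replicate (Suc n) 0)
        = (exp (v * c) - (\<Sum>j<Suc n. (v * c) ^ j / fact j)) / v ^ n"
      using assms(2) by (simp add: Suc diff_divide_distrib add_divide_distrib power_mult_distrib)
    then show ?case using assms(2) by (simp add: field_simps)
  qed
  also have "dde r c (v # replicate n 0) = dde r c (replicate n 0 @ [v])"
    by (rule ddc_perm) simp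
  finally show ?thesis .
qed

lemma dde_zeros_insert2:
  assumes "norm u < r" "norm v < r"
  shows "(u - v) * dde r c (replicate n 0 @ [u, v])
     = dde r c (replicate n 0 @ [u]) - dde r c (replicate n 0 @ [v])"
proof -
  have r: "r > 0" using assms(1) by (auto intro: le_less_trans[OF norm_ge_zero])
  have "(u - v) * dde r c (u # v # replicate n 0) = dde r c (u # replicate n 0) - dde r c (v # replicate n 0)"
    by (rule ddc_recurrence) (use assms r in \<open>auto intro!: holomorphic_intros simp: path_image_circlepath_nonneg\<close>)
  moreover have "dde r c (u # v # replicate n 0) = dde r c (replicate n 0 @ [u, v])"
    "dde r c (u # replicate n 0) = dde r c (replicate n 0 @ [u])"
    "dde r c (v # replicate n 0) = dde r c (replicate n 0 @ [v])"
    by (rule ddc_perm; simp)+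
  ultimately show ?thesis by simp
qed

lemma map_zeros [simp]: "map zeros [0..<n] = replicate n 0"
  by (simp add: zeros_def map_replicate_const)

lemma dd_mat_zeros: "r > 0 \<Longrightarrow> dd_mat r l zeros i m = l m ^ i / fact i"
  unfolding dd_mat_def map_zeros by (rule dde_zeros)

lemma det_dd_mat_zeros_nonzero:
  assumes "inj_on l {..<n}" "r > 0"
  shows "detn n (dd_mat r l zeros) \<noteq> 0"
proof -
  have "detn n (dd_mat r l zeros) = detn n (\<lambda>i m. (1 / fact i) * l m ^ i)"
    by (rule detn_cong) (simp add: dd_mat_zeros assms(2))
  then show ?thesis using detn_vandermonde_nonzero[OF assms(1), of "\<lambda>i. 1 / fact i"] by simp
qed

section \<open>Coalescing arguments\<close>

lemma tendsto_funI:
  fixes f :: "'a \<Rightarrow> 'b \<Rightarrow> 'c::topological_space"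
  assumes "\<And>i. ((\<lambda>t. f t i) \<longlongrightarrow> g i) F"
  shows "(f \<longlongrightarrow> g) F"
proof -
  have "limitin (product_topology (\<lambda>_. euclidean) UNIV) f g F"
    using assms by (simp add: limitin_componentwise)
  then show ?thesis by (simp add: euclidean_product_topology)
qed

lemma tendsto_funD:
  fixes f :: "'a \<Rightarrow> 'b \<Rightarrow> 'c::topological_space"
  assumes "(f \<longlongrightarrow> g) F"
  shows "((\<lambda>t. f t i) \<longlongrightarrow> g i) F"
proof -
  have "limitin (product_topology (\<lambda>_. euclidean) UNIV) f g F"
    using assms by (simp add: euclidean_product_topology)
  then show ?thesis by (simp add: limitin_componentwise)
qed

text \<open>\<open>Lim\<close> is determined by convergence only along a nontrivial filter. A curve
  through \<open>S\<close> with limit \<open>z0\<close> puts \<open>z0\<close> into the closure of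
  \<open>S\<close>.\<close>

lemma at_within_nontrivial:
  fixes z0 :: "'b::t1_space"
  assumes "(h \<longlongrightarrow> z0) F" "F \<noteq> bot" "eventually (\<lambda>t. h t \<in> S) F" "z0 \<notin> S"
  shows "at z0 within S \<noteq> bot"
proof -
  have "z0 \<in> closure S"
    by (rule Lim_in_closed_set[OF closed_closure eventually_mono[OF assms(3)] assms(2,1)])
       (use closure_subset in blast)
  then show ?thesis using assms(4) by (simp add: at_within_eq_bot_iff)
qed

text \<open>Shifting with speeds proportional to the index separates equal points at once, while
  unequal points stay unequal for small shifts.\<close>

lemma eventually_perturbation_inj:
  fixes y :: "nat \<Rightarrow> complex"
  shows "eventually (\<lambda>\<epsilon>. inj_on (\<lambda>i. y i + of_real \<epsilon> * of_nat i) {..<n}) (at_right 0)"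
proof -
  have 1: "eventually (\<lambda>\<epsilon>. y i + of_real \<epsilon> * of_nat i \<noteq> y j + of_real \<epsilon> * of_nat j) (at_right 0)"
    if "i \<noteq> j" for i j
  proof (cases "y i = y j")
    case True
    then show ?thesis using that
      by (intro eventually_mono[OF eventually_at_right_less]) auto
  next
    case False
    have "((\<lambda>\<epsilon>. (y i + of_real \<epsilon> * of_nat i) - (y j + of_real \<epsilon> * of_nat j)) \<longlongrightarrow>
        (y i + of_real 0 * of_nat i) - (y j + of_real 0 * of_nat j)) (at_right 0)"
      by (intro tendsto_intros)
    then have "eventually (\<lambda>\<epsilon>. (y i + of_real \<epsilon> * of_nat i) - (y j + of_real \<epsilon> * of_nat j) \<noteq> 0) (at_right 0)"
      by (rule tendsto_imp_eventually_ne) (use False in simp)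
    then show ?thesis by eventually_elim auto
  qed
  have "eventually (\<lambda>\<epsilon>. \<forall>i\<in>{..<n}. \<forall>j\<in>{..<n}. i \<noteq> j \<longrightarrow>
      y i + of_real \<epsilon> * of_nat i \<noteq> y j + of_real \<epsilon> * of_nat j) (at_right 0)"
    by (intro eventually_ball_finite ballI) (use 1 in auto)
  then show ?thesis by eventually_elim (auto simp: inj_on_def)
qed

lemma perturbation_tendsto:
  fixes z :: "nat \<Rightarrow> complex"
  shows "((\<lambda>\<epsilon> i. if i < n then z i + of_real \<epsilon> * c i else z i) \<longlongrightarrow> z) (at_right (0::real))"
proof (rule tendsto_funI)
  fix i
  have "((\<lambda>\<epsilon>. z i + of_real \<epsilon> * c i) \<longlongrightarrow> z i + of_real 0 * c i) (at_right (0::real))"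
    by (intro tendsto_intros)
  then show "((\<lambda>\<epsilon>. if i < n then z i + of_real \<epsilon> * c i else z i) \<longlongrightarrow> z i) (at_right (0::real))"
    by (cases "i < n") auto
qed

lemma B_nontrivial:
  fixes z :: "nat \<Rightarrow> complex"
  assumes "\<not> distinct_upto n z"
  shows "at z within {z'. distinct_upto n z' \<and> (\<forall>i\<ge>n. z' i = z i)} \<noteq> bot"
proof (rule at_within_nontrivial[OF perturbation_tendsto[of n z of_nat]])
  show "eventually (\<lambda>\<epsilon>. (\<lambda>i. if i < n then z i + of_real \<epsilon> * of_nat i else z i)
      \<in> {z'. distinct_upto n z' \<and> (\<forall>i\<ge>n. z' i = z i)}) (at_right 0)"
    using eventually_perturbation_inj[of z n]
    by eventually_elim (auto simp: distinct_upto_def inj_on_def)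
qed (use assms in auto)

lemma Bp_nontrivial:
  assumes "\<not> generic_uv n k (u, v)"
  shows "at (u, v) within {uv'. generic_uv n k uv' \<and>
      (\<forall>i\<ge>n+k. fst uv' i = u i) \<and> (\<forall>j\<ge>k. snd uv' j = v j)} \<noteq> bot"
proof (rule at_within_nontrivial[OF tendsto_Pair[OF perturbation_tendsto[of "n + k" u of_nat]
          perturbation_tendsto[of k v "\<lambda>j. of_nat (n + k + j)"]]])
  \<comment> \<open>Joining \<open>u\<close> and \<open>v\<close> into one family of
    \<open>n + k + k\<close> points, with the offset \<open>n + k + j\<close> in the speeds for
    \<open>v\<close>, obtains all the genericity conditions from a single injectivity
    statement.\<close>
  define y where "y i = (if i < n + k then u i else v (i - (n + k)))" for i
  show "eventually (\<lambda>\<epsilon>. (\<lambda>i. if i < n + k then u i + of_real \<epsilon> * of_nat i else u i,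
        \<lambda>j. if j < k then v j + of_real \<epsilon> * of_nat (n + k + j) else v j)
      \<in> {uv'. generic_uv n k uv' \<and> (\<forall>i\<ge>n+k. fst uv' i = u i) \<and> (\<forall>j\<ge>k. snd uv' j = v j)}) (at_right 0)"
    using eventually_perturbation_inj[of y "n + k + k"]
  proof eventually_elim
    case (elim \<epsilon>)
    have U: "y i + of_real \<epsilon> * of_nat i = u i + of_real \<epsilon> * of_nat i" if "i < n + k" for i
      using that by (simp add: y_def)
    have V: "y (n + k + j) + of_real \<epsilon> * of_nat (n + k + j) = v j + of_real \<epsilon> * of_nat (n + k + j)" for j
      by (simp add: y_def)
    have "inj_on (\<lambda>i. if i < n + k then u i + of_real \<epsilon> * of_nat i else u i) {..<n + k}"
    proof (rule inj_onI)
      fix i j assume "i \<in> {..<n + k}" "j \<in> {..<n + k}"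
        "(if i < n + k then u i + of_real \<epsilon> * of_nat i else u i) = (if j < n + k then u j + of_real \<epsilon> * of_nat j else u j)"
      then show "i = j" using inj_onD[OF elim, of i j] U[of i] U[of j] by simp
    qed
    moreover have "inj_on (\<lambda>j. if j < k then v j + of_real \<epsilon> * of_nat (n + k + j) else v j) {..<k}"
    proof (rule inj_onI)
      fix i j assume "i \<in> {..<k}" "j \<in> {..<k}"
        "(if i < k then v i + of_real \<epsilon> * of_nat (n + k + i) else v i) = (if j < k then v j + of_real \<epsilon> * of_nat (n + k + j) else v j)"
      then show "i = j" using inj_onD[OF elim, of "n + k + i" "n + k + j"] V[of i] V[of j] by simp
    qed
    moreover have "u i + of_real \<epsilon> * of_nat i \<noteq> v j + of_real \<epsilon> * of_nat (n + k + j)"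
      if "i < n + k" "j < k" for i j
      using inj_onD[OF elim, of i "n + k + j"] U[of i] V[of j] that by auto
    ultimately show ?case by (auto simp: generic_uv_def distinct_upto_def)
  qed
qed (use assms in auto)

section \<open>Values at confluent arguments\<close>

lemma B_zeros:
  assumes "inj_on l {..<n}" "r > 0"
  shows "B n l zeros = (\<Prod>j<n. (-1) ^ j) * detn n (dd_mat r (\<lambda>m. of_real (l m)) zeros)"
\<comment> \<open>The zero vector counts as distinct exactly for \<open>n\<close> at most 1, where
  the raw quotient is the value; otherwise the value is a limit.\<close>
proof (cases "distinct_upto n zeros")
  case True
  then show ?thesis
    using B_raw_eq_dd_mat[of zeros n r l] assms(2) by (simp add: B_def distinct_upto_def zeros_def)
next
  case False
  let ?F = "at zeros within {z'. distinct_upto n z' \<and> (\<forall>i\<ge>n. z' i = zeros i)}"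
  have co: "((\<lambda>z. z i) \<longlongrightarrow> zeros i) ?F" for i
    by (rule tendsto_funD[OF tendsto_ident_at])
  have "((\<lambda>z. (\<Prod>j<n. (-1) ^ j) * detn n (dd_mat r (\<lambda>m. of_real (l m)) z)) \<longlongrightarrow>
      (\<Prod>j<n. (-1) ^ j) * detn n (dd_mat r (\<lambda>m. of_real (l m)) zeros)) ?F"
    by (intro tendsto_mult tendsto_const tendsto_detn tendsto_dd_mat[of n])
       (use co assms(2) in \<open>auto simp: zeros_def\<close>)
  moreover have "eventually (\<lambda>z. \<forall>a\<in>{..<n}. norm (z a) < r) ?F"
    using co assms(2) by (intro eventually_ball_finite ballI order_tendstoD(2)[OF tendsto_norm[OF co]])
      (auto simp: zeros_def)
  then have "eventually (\<lambda>z. (\<Prod>j<n. (-1) ^ j) * detn n (dd_mat r (\<lambda>m. of_real (l m)) z) = B_raw n l z) ?F"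
    unfolding eventually_at_filter
    by eventually_elim (auto simp: distinct_upto_def intro!: B_raw_eq_dd_mat[symmetric])
  ultimately have "(B_raw n l \<longlongrightarrow> (\<Prod>j<n. (-1) ^ j) * detn n (dd_mat r (\<lambda>m. of_real (l m)) zeros)) ?F"
    by (rule Lim_transform_eventually)
  then show ?thesis
    using tendsto_Lim[OF B_nontrivial[OF False]] False by (simp add: B_def)
qed

lemma B_zeros_nonzero: "inj_on l {..<n} \<Longrightarrow> B n l zeros \<noteq> 0"
  using det_dd_mat_zeros_nonzero[of "\<lambda>m. complex_of_real (l m)" n 1]
  by (subst B_zeros[of _ _ 1]) (auto simp: inj_on_def)

text \<open>The factorization at generic points has a right side that is continuous at the confluent
  point, so it computes the limit defining \<open>Bp\<close>; the factor belonging to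
  \<open>B\<close> then cancels.\<close>

lemma Bp_over_B_zeros:
  fixes u v :: "nat \<Rightarrow> complex" and l :: "nat \<Rightarrow> real"
  assumes inj: "inj_on u {..<k}" "inj_on v {..<k}" "\<And>i j. i < k \<Longrightarrow> j < k \<Longrightarrow> u i \<noteq> v j"
    and r: "\<And>i. i < k \<Longrightarrow> norm (u i) < r" "\<And>j. j < k \<Longrightarrow> norm (v j) < r" "r > 0"
    and l: "inj_on l {..<n}"
  shows "Bp n k l p (\<lambda>i. if i < k then u i else 0) v / B n l zeros
     = (\<Prod>i<k. \<Prod>j<k. (u i - v j))
        / (\<Prod>(i,j) \<in> {(i,j). i < j \<and> j < k}. (u i - u j) * (v j - v i))
      * detn k (\<lambda>i j. 1 / (u i - v j) * ratio1 r n p (\<lambda>m. of_real (l m)) (u i) zeros (v j))"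
    (is "_ = ?R")
proof -
  define L where "L = (\<lambda>m. complex_of_real (l m))"
  define U where "U i = (if i < k then u i else 0)" for i
  have lL: "inj_on L {..<n}" using l by (auto simp: inj_on_def L_def)
  define s where "s = (\<Prod>j<n. (-1 :: complex) ^ j)"
  \<comment> \<open>The continuous expression that agrees with \<open>Bp_raw\<close> at generic
    arguments inside the circle where the determinant does not vanish.\<close>
  define H where "H = (\<lambda>(U, V). s * detn n (dd_mat r L (\<lambda>a. U (k + a))) *
     ((\<Prod>i<k. \<Prod>j<k. (U i - V j)) / (\<Prod>j<k. \<Prod>i<j. (U i - U j) * (V j - V i))
      * detn k (\<lambda>i j. 1 / (U i - V j) * ratio1 r n p L (U i) (\<lambda>a. U (k + a)) (V j))))"
  have zer: "(\<lambda>a. U (k + a)) = zeros" by (auto simp: U_def zeros_def)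
  have d: "detn n (dd_mat r L zeros) \<noteq> 0"
    by (rule det_dd_mat_zeros_nonzero[OF lL r(3)])
  have raw: "Bp_raw n k l p uv = H uv"
    if "generic_uv n k uv" "\<forall>i\<in>{..<n + k}. norm (fst uv i) < r" "\<forall>j\<in>{..<k}. norm (snd uv j) < r"
      "detn n (dd_mat r L (\<lambda>a. fst uv (k + a))) \<noteq> 0" for uv
  proof -
    obtain U' V' where uv: "uv = (U', V')" by (cases uv)
    have "B_raw n l (\<lambda>a. U' (k + a)) = s * detn n (dd_mat r L (\<lambda>a. U' (k + a)))"
      unfolding s_def L_def
    proof (rule B_raw_eq_dd_mat)
      have "inj_on U' {..<n + k}" using that(1) by (simp add: uv generic_uv_def distinct_upto_def)
      from inj_onD[OF this, of "k + _" "k + _"] show "inj_on (\<lambda>a. U' (k + a)) {..<n}"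
        by (intro inj_onI) auto
    qed (use that in \<open>auto simp: uv\<close>)
    moreover have "Bp_raw n k l p (U', V') = B_raw n l (\<lambda>a. U' (k + a)) *
       ((\<Prod>i<k. \<Prod>j<k. (U' i - V' j))
          / (\<Prod>(i,j) \<in> {(i,j). i < j \<and> j < k}. (U' i - U' j) * (V' j - V' i))
        * detn k (\<lambda>i j. 1 / (U' i - V' j) * ratio1 r n p (\<lambda>m. of_real (l m)) (U' i) (\<lambda>a. U' (k + a)) (V' j)))"
      by (rule Bp_raw_factorization) (use that in \<open>auto simp: uv L_def\<close>)
    ultimately show ?thesis by (simp add: H_def uv prod_pairs_less L_def)
  qed
  have nU: "norm (U i) < r" for i using r by (simp add: U_def)
  have "Bp n k l p U v = H (U, v)"
  proof (cases "generic_uv n k (U, v)")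
    case True
    then show ?thesis using raw[of "(U, v)"] nU r d by (simp add: Bp_def zer)
  next
    case False
    let ?F = "at (U, v) within {uv'. generic_uv n k uv' \<and>
      (\<forall>i\<ge>n+k. fst uv' i = U i) \<and> (\<forall>j\<ge>k. snd uv' j = v j)}"
    have cU: "((\<lambda>uv. fst uv i) \<longlongrightarrow> U i) ?F" for i
      using tendsto_funD[OF tendsto_fst[OF tendsto_ident_at]] by fastforce
    have cV: "((\<lambda>uv. snd uv i) \<longlongrightarrow> v i) ?F" for i
      using tendsto_funD[OF tendsto_snd[OF tendsto_ident_at]] by fastforce
    have cx: "((\<lambda>uv. fst uv (k + a)) \<longlongrightarrow> zeros a) ?F" for a
      using cU[of "k + a"] by (simp add: U_def zeros_def)
    \<comment> \<open>The determinant is nonzero at the limit by the Vandermonde argument, hence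
      nonzero nearby, as \<open>raw\<close> requires.\<close>
    have cd: "((\<lambda>uv. detn n (dd_mat r L (\<lambda>a. fst uv (k + a)))) \<longlongrightarrow> detn n (dd_mat r L zeros)) ?F"
      by (intro tendsto_detn tendsto_dd_mat[of n]) (use cx r in \<open>auto simp: zeros_def\<close>)
    have Uu: "U i = u i" if "i < k" for i using that by (simp add: U_def)
    have "((\<lambda>uv. H (fst uv, snd uv)) \<longlongrightarrow> H (U, v)) ?F"
      unfolding H_def case_prod_conv zer
    proof (intro tendsto_mult tendsto_divide tendsto_prod tendsto_diff tendsto_const tendsto_detn cU cV
          tendsto_dd_mat[of n] cx tendsto_ratio1)
      show "(\<Prod>j<k. \<Prod>i<j. (U i - U j) * (v j - v i)) \<noteq> 0"
        using inj_onD[OF inj(1)] inj_onD[OF inj(2)] by (fastforce simp: U_def)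
    qed (use r nU d inj in \<open>auto simp: zeros_def Uu\<close>)
    moreover have "eventually (\<lambda>uv. H (fst uv, snd uv) = Bp_raw n k l p uv) ?F"
    proof -
      have "eventually (\<lambda>uv. \<forall>i\<in>{..<n + k}. norm (fst uv i) < r) ?F"
        by (intro eventually_ball_finite ballI order_tendstoD(2)[OF tendsto_norm[OF cU]]) (use nU in auto)
      moreover have "eventually (\<lambda>uv. \<forall>j\<in>{..<k}. norm (snd uv j) < r) ?F"
        by (intro eventually_ball_finite ballI order_tendstoD(2)[OF tendsto_norm[OF cV]]) (use r in auto)
      moreover have "eventually (\<lambda>uv. detn n (dd_mat r L (\<lambda>a. fst uv (k + a))) \<noteq> 0) ?F"
        by (rule tendsto_imp_eventually_ne[OF cd d])
      moreover have "eventually (\<lambda>uv. generic_uv n k uv) ?F"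
        by (simp add: eventually_at_filter)
      ultimately show ?thesis
        by eventually_elim (simp add: raw)
    qed
    ultimately have "(Bp_raw n k l p \<longlongrightarrow> H (U, v)) ?F"
      by (rule Lim_transform_eventually)
    then show ?thesis
      using tendsto_Lim[OF Bp_nontrivial[OF False]] False by (simp add: Bp_def)
  qed
  moreover have "H (U, v) = s * detn n (dd_mat r L zeros) * ?R"
  proof -
    have "(\<Prod>j<k. \<Prod>i<j. (U i - U j) * (v j - v i)) = (\<Prod>j<k. \<Prod>i<j. (u i - u j) * (v j - v i))"
      by (intro prod.cong) (auto simp: U_def)
    moreover have "(\<Prod>i<k. \<Prod>j<k. (U i - v j)) = (\<Prod>i<k. \<Prod>j<k. (u i - v j))"
      by (intro prod.cong) (auto simp: U_def)
    moreover have "detn k (\<lambda>i j. 1 / (U i - v j) * ratio1 r n p L (U i) zeros (v j))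
       = detn k (\<lambda>i j. 1 / (u i - v j) * ratio1 r n p L (u i) zeros (v j))"
      by (intro detn_cong) (auto simp: U_def)
    ultimately show ?thesis by (simp add: H_def zer prod_pairs_less flip: L_def)
  qed
  moreover have "B n l zeros = s * detn n (dd_mat r L zeros)"
    unfolding s_def L_def by (rule B_zeros[OF l r(3)])
  moreover have "B n l zeros \<noteq> 0" by (rule B_zeros_nonzero[OF l])
  ultimately show ?thesis unfolding U_def by simp
qed

corollary Bp1_over_B_zeros:
  assumes "u \<noteq> v" "norm u < r" "norm v < r" "inj_on l {..<n}"
  shows "Bp n 1 l p (\<lambda>a. if a = 0 then u else 0) (\<lambda>b. if b = 0 then v else 0) / B n l zeros
     = ratio1 r n p (\<lambda>m. of_real (l m)) u zeros v"
proof -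
  have r: "r > 0" using assms(2) by (auto intro: le_less_trans[OF norm_ge_zero])
  have "Bp n 1 l p (\<lambda>i. if i < 1 then u else 0) (\<lambda>b. if b = 0 then v else 0) / B n l zeros
     = (\<Prod>i<1::nat. \<Prod>j<1::nat. (u - (if j = 0 then v else 0)))
        / (\<Prod>(i,j) \<in> {(i,j). i < j \<and> j < (1::nat)}. (u - u) * ((if j = 0 then v else 0) - (if i = 0 then v else 0)))
      * detn 1 (\<lambda>i (j::nat). 1 / (u - (if j = 0 then v else 0))
          * ratio1 r n p (\<lambda>m. of_real (l m)) u zeros (if j = 0 then v else 0))"
    by (rule Bp_over_B_zeros[where u = "\<lambda>_. u" and v = "\<lambda>b. if b = 0 then v else 0"])
       (use assms r in \<open>auto simp: inj_on_def\<close>)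
  then show ?thesis using assms(1) unfolding prod_pairs_less
    by (simp add: detn_def lessThan_Suc sign_id)
qed

section \<open>Coalescing parameters\<close>

text \<open>The value at \<open>w\<^sup>i (w - l\<^sub>0) \<cdots> (w - l\<^bsub>m-1\<^esub>)\<close> of the linear functional \<open>w\<^sup>i \<mapsto> a i\<close>.\<close>

primrec newton_functional :: "(nat \<Rightarrow> complex) \<Rightarrow> (nat \<Rightarrow> complex) \<Rightarrow> nat \<Rightarrow> nat \<Rightarrow> complex" where
  "newton_functional a l 0 i = a i"
| "newton_functional a l (Suc m) i = newton_functional a l m (Suc i) - l m * newton_functional a l m i"

text \<open>Splitting off the last factor y - l_m reproduces the recursion of
  \<open>newton_functional\<close>. Moments are prescribed only for exponents below
  \<open>n\<close>, hence the bound on \<open>m + i\<close>.\<close>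

lemma newton_functional_sum:
  assumes "\<And>i. i < n \<Longrightarrow> (\<Sum>s\<in>S. c s * y s ^ i) = a i" and "m + i < n"
  shows "(\<Sum>s\<in>S. c s * (y s ^ i * (\<Prod>j<m. y s - l j))) = newton_functional a l m i"
  using assms(2)
proof (induction m arbitrary: i)
  case (Suc m)
  have "(\<Sum>s\<in>S. c s * (y s ^ i * (\<Prod>j<Suc m. y s - l j)))
      = (\<Sum>s\<in>S. c s * (y s ^ Suc i * (\<Prod>j<m. y s - l j)) - l m * (c s * (y s ^ i * (\<Prod>j<m. y s - l j))))"
    by (rule sum.cong) (auto simp: algebra_simps)
  also have "\<dots> = newton_functional a l (Suc m) i"
    using Suc.IH[of i] Suc.IH[of "Suc i"] Suc.prems
    by (simp add: sum_subtractf flip: sum_distrib_left)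
  finally show ?case .
qed (use assms(1) in simp)

lemma tendsto_newton_functional:
  assumes "\<And>j. ((\<lambda>t. l t j) \<longlongrightarrow> l0 j) F"
  shows "((\<lambda>t. newton_functional a (l t) m i) \<longlongrightarrow> newton_functional a l0 m i) F"
  by (induction m arbitrary: i) (auto intro!: tendsto_intros assms)

text \<open>Replacing \<open>g\<close> by its Newton polynomial eliminates the weights
  \<open>c\<close>, which come from Cramer's rule and degenerate as the \<open>l s\<close> coalesce.
  The right side involves only the moments and divided differences.\<close>

lemma sum_eq_newton_form:
  assumes g: "g holomorphic_on UNIV"
    and c: "\<And>i. i < n \<Longrightarrow> (\<Sum>s<n. c s * l s ^ i) = a i"
    and r: "\<And>i. i < n \<Longrightarrow> norm (l i) < r"
  shows "(\<Sum>s<n. c s * g (l s))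
     = (\<Sum>m<n. ddc (circlepath 0 r) g (map l [0..<Suc m]) * newton_functional a l m 0)"
proof -
  let ?D = "\<lambda>m. ddc (circlepath 0 r) g (map l [0..<Suc m])"
  have "g (l s) = (\<Sum>m<n. ?D m * (\<Prod>i<m. l s - l i))" if s: "s < n" for s
  proof -
    have "r > 0" using r[OF s] by (auto intro: le_less_trans[OF norm_ge_zero])
    then have off: "l i \<notin> path_image (circlepath 0 r)" if "i < n" for i
      using r[OF that] by (simp add: path_image_circlepath_nonneg)
    have "ddc (circlepath 0 r) g [l s] = winding_number (circlepath 0 r) (l s) * g (l s)"
      by (rule ddc_single) (use g off s in auto)
    moreover have "ddc (circlepath 0 r) g [l s] = (\<Sum>m<n. ?D m * (\<Prod>i<m. l s - l i))
        + (\<Prod>i<n. l s - l i) * ddc (circlepath 0 r) g (l s # map l [0..<n])"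
      by (rule ddc_newton) (use g off s in auto)
    \<comment> \<open>The Newton remainder drops out because l_s is itself one of the nodes.\<close>
    moreover have "(\<Prod>i<n. l s - l i) = 0" using s by auto
    ultimately show ?thesis using r[OF s] by (simp add: winding_number_circlepath)
  qed
  then have "(\<Sum>s<n. c s * g (l s)) = (\<Sum>s<n. \<Sum>m<n. ?D m * (c s * (\<Prod>i<m. l s - l i)))"
    by (simp add: sum_distrib_left mult_ac del: upt_Suc)
  also have "\<dots> = (\<Sum>m<n. ?D m * (\<Sum>s<n. c s * (l s ^ 0 * (\<Prod>i<m. l s - l i))))"
    by (subst sum.swap) (simp add: sum_distrib_left del: upt_Suc)
  also have "\<dots> = (\<Sum>m<n. ?D m * newton_functional a l m 0)"
    by (intro sum.cong refl arg_cong2[where f = "(*)"] newton_functional_sum[where n = n]) (use c in auto)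
  finally show ?thesis .
qed

text \<open>For nonzero \<open>v\<close> and \<open>i < n\<close> this is v^n times the
  \<open>i\<close>-th derivative at 0 of e^{p(z-v)}/(z-v).\<close>

definition moment :: "real \<Rightarrow> nat \<Rightarrow> complex \<Rightarrow> complex \<Rightarrow> nat \<Rightarrow> complex" where
  "moment r n p v i = fact i * dd_rhs r n p zeros v i"

text \<open>The linear functional with moments \<open>a\<close>, applied to the Newton interpolation
  polynomial of \<open>g\<close> at the points \<open>l\<close>, which may coincide.\<close>

definition newton_form :: "real \<Rightarrow> nat \<Rightarrow> (complex \<Rightarrow> complex) \<Rightarrow> (nat \<Rightarrow> complex) \<Rightarrow> (nat \<Rightarrow> complex) \<Rightarrow> complex" where
  "newton_form r n g a l = (\<Sum>m<n. ddc (circlepath 0 r) g (map l [0..<Suc m]) * newton_functional a l m 0)"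

lemma tendsto_newton_form:
  assumes "\<And>i. ((\<lambda>t. l t i) \<longlongrightarrow> l0 i) F" "\<And>i. i < n \<Longrightarrow> norm (l0 i) < r" "r > 0"
    and "g holomorphic_on UNIV"
  shows "((\<lambda>t. newton_form r n g a (l t)) \<longlongrightarrow> newton_form r n g a l0) F"
  unfolding newton_form_def
proof (intro tendsto_sum tendsto_mult tendsto_newton_functional assms(1))
  fix m assume m: "m \<in> {..<n}"
  have "((\<lambda>t. ddc (circlepath 0 r) g (map (\<lambda>f. f t) (map (\<lambda>i t. l t i) [0..<Suc m])))
      \<longlongrightarrow> ddc (circlepath 0 r) g (map l0 [0..<Suc m])) F"
    by (rule tendsto_ddc)
       (use assms m in \<open>auto simp: list_all2_conv_all_nth simp del: upt_Suc\<close>)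
  then show "((\<lambda>t. ddc (circlepath 0 r) g (map (l t) [0..<Suc m]))
      \<longlongrightarrow> ddc (circlepath 0 r) g (map l0 [0..<Suc m])) F"
    by (simp add: o_def del: upt_Suc)
qed

text \<open>With all nodes at 0 the \<open>i\<close>-th row of the system consists of the powers
  l_m^i divided by \<open>fact i\<close>, so the Cramer coefficients are weights at the points l_m
  that represent the functional.\<close>

lemma cramer_zeros_moments:
  assumes "inj_on l {..<n}" "r > 0" "i < n"
  shows "(\<Sum>m<n. cramer n (dd_mat r l zeros) (dd_rhs r n p zeros v) m * l m ^ i) = moment r n p v i"
proof -
  have "(\<Sum>m<n. dd_mat r l zeros i m * cramer n (dd_mat r l zeros) (dd_rhs r n p zeros v) m)
      = dd_rhs r n p zeros v i"
    by (rule cramer_solves[OF det_dd_mat_zeros_nonzero[OF assms(1,2)] assms(3)])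
  then have "fact i * (\<Sum>m<n. l m ^ i / fact i * cramer n (dd_mat r l zeros) (dd_rhs r n p zeros v) m)
      = moment r n p v i"
    by (simp add: dd_mat_zeros[OF assms(2)] moment_def)
  then show ?thesis by (simp add: sum_distrib_left mult_ac)
qed

text \<open>Here the exponent is the variable: this function of \<open>c\<close> is the one that
  gets interpolated at the points l_m. The case \<open>u = 0\<close> is included because the
  determinantal formula allows a vanishing argument.\<close>

lemma dde_zeros_holomorphic:
  assumes "norm u < r"
  shows "(\<lambda>c. dde r c (replicate n 0 @ [u])) holomorphic_on UNIV"
proof (cases "u = 0")
  case True
  have "r > 0" using assms by (auto intro: le_less_trans[OF norm_ge_zero])
  have "replicate n 0 @ [u] = replicate (Suc n) 0"
    using True by (simp add: replicate_append_same)
  then have "(\<lambda>c. dde r c (replicate n 0 @ [u])) = (\<lambda>c. c ^ n / fact n)"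
    using dde_zeros[OF \<open>r > 0\<close>] by simp
  then show ?thesis by (simp only:) (intro holomorphic_intros, simp)
next
  case False
  then show ?thesis unfolding dde_zeros_insert[OF assms False]
    by (intro holomorphic_intros) auto
qed

text \<open>Eliminating the Cramer coefficients leaves an expression that extends continuously to
  repeated values of \<open>l\<close>.\<close>

lemma ratio1_zeros:
  assumes "inj_on l {..<n}" "\<And>i. i < n \<Longrightarrow> norm (l i) < r" "norm u < r"
  shows "ratio1 r n p l u zeros v = 1
     + (u - v) * (v ^ n * exp (- p * v) * dde r p (replicate n 0 @ [u, v]))
     - (u - v) * newton_form r n (\<lambda>c. dde r c (replicate n 0 @ [u])) (moment r n p v) l"
proof -
  have r: "r > 0" using assms(3) by (auto intro: le_less_trans[OF norm_ge_zero])
  have "(\<Sum>m<n. cramer n (dd_mat r l zeros) (dd_rhs r n p zeros v) m * dde r (l m) (replicate n 0 @ [u]))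
      = newton_form r n (\<lambda>c. dde r c (replicate n 0 @ [u])) (moment r n p v) l"
    unfolding newton_form_def
    by (rule sum_eq_newton_form[where g = "\<lambda>c. dde r c (replicate n 0 @ [u])"])
       (use assms r cramer_zeros_moments dde_zeros_holomorphic in auto)
  then show ?thesis by (simp add: ratio1_def zeros_def flip: map_zeros)
qed

text \<open>Evaluates the sum that arises when the moments are paired with the Taylor polynomial of
  e^{zu}. Passing from \<open>n\<close> to \<open>Suc n\<close> multiplies the old sum by
  \<open>v\<close> and adds one term.\<close>

lemma telescoping_exp_sums:
  fixes u v p :: complex
  shows "(u - v) * (\<Sum>j<n. u ^ j * (v ^ (n - Suc j) * (\<Sum>i<Suc j. (v * p) ^ i / fact i)))
     = u ^ n * (\<Sum>i<n. (v * p) ^ i / fact i) - v ^ n * (\<Sum>i<n. (u * p) ^ i / fact i)"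
proof (induction n)
  case (Suc n)
  let ?s = "\<lambda>w n. \<Sum>i<n. (w * p) ^ i / fact i"
  have pow: "v ^ (Suc n - Suc j) = v * v ^ (n - Suc j)" if "j < n" for j
    using that by (simp add: Suc_diff_Suc flip: power_Suc)
  have "(\<Sum>j<Suc n. u ^ j * (v ^ (Suc n - Suc j) * ?s v (Suc j)))
      = (\<Sum>j<n. u ^ j * (v ^ (Suc n - Suc j) * ?s v (Suc j))) + u ^ n * ?s v (Suc n)"
    by (subst sum.lessThan_Suc) simp
  also have "(\<Sum>j<n. u ^ j * (v ^ (Suc n - Suc j) * ?s v (Suc j)))
      = (\<Sum>j<n. v * (u ^ j * (v ^ (n - Suc j) * ?s v (Suc j))))"
  proof (rule sum.cong[OF refl])
    fix j assume "j \<in> {..<n}"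
    then show "u ^ j * (v ^ (Suc n - Suc j) * ?s v (Suc j)) = v * (u ^ j * (v ^ (n - Suc j) * ?s v (Suc j)))"
      by (subst pow) (simp_all only: lessThan_iff mult_ac)
  qed
  also have "\<dots> = v * (\<Sum>j<n. u ^ j * (v ^ (n - Suc j) * ?s v (Suc j)))"
    by (rule sum_distrib_left[symmetric])
  finally have "(u - v) * (\<Sum>j<Suc n. u ^ j * (v ^ (Suc n - Suc j) * ?s v (Suc j)))
      = v * (u ^ n * ?s v n - v ^ n * ?s u n) + (u - v) * (u ^ n * ?s v (Suc n))"
    unfolding Suc[symmetric] by (simp only: ring_distribs mult_ac)
  also have "\<dots> = u ^ Suc n * ?s v (Suc n) - v ^ Suc n * ?s u (Suc n)"
    by (simp add: algebra_simps power_mult_distrib diff_divide_distrib)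
  finally show ?case .
qed simp

text \<open>The full exponential in the Taylor remainder cancels the second term of
  \<open>dd_rhs\<close>, which leaves the truncated series.\<close>

lemma dd_rhs_zeros:
  assumes "norm v < r" "v \<noteq> 0" "i < n"
  shows "dd_rhs r n p zeros v i
     = - (v ^ (n - Suc i) * (exp (- p * v) * (\<Sum>j<Suc i. (v * p) ^ j / fact j)))"
proof -
  have "card {i<..<n} = n - Suc i" by simp
  moreover have "v ^ n = v ^ (n - Suc i) * v ^ Suc i"
    using assms(3) power_add[of v "n - Suc i" "Suc i"] by simp
  moreover have "exp (- p * v) * exp (v * p) = 1" by (simp flip: exp_add)
  moreover have "(v ^ (n - Suc i) * v ^ Suc i) * e * ((f - s) / v ^ Suc i) - v ^ (n - Suc i)
      = - (v ^ (n - Suc i) * (e * s))" if ef: "e * f = 1" for e f s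
  proof -
    have "(a * b) * e * ((f - s) / b) = a * (e * f) - a * (e * s)" if "b \<noteq> 0" for a b
      using that by (simp add: field_simps)
    then have 1: "(v ^ (n - Suc i) * v ^ Suc i) * e * ((f - s) / v ^ Suc i)
        = v ^ (n - Suc i) * (e * f) - v ^ (n - Suc i) * (e * s)"
      using assms(2) power_not_zero by blast
    show ?thesis unfolding 1 ef by simp
  qed
  ultimately show ?thesis
    unfolding dd_rhs_def map_zeros dde_zeros_insert[OF assms(1,2)] by (simp add: zeros_def)
qed

text \<open>For nonzero arguments each divided difference at zero nodes splits into an exponential
  and a Taylor polynomial. The polynomial parts cancel, so the functional is applied to e^{zu}
  itself, as the contour integral requires.\<close>

lemma ratio1_zeros_nonzero_args:
  assumes "inj_on l {..<n}" "\<And>i. i < n \<Longrightarrow> norm (l i) < r"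
    and u: "norm u < r" "u \<noteq> 0" and v: "norm v < r" "v \<noteq> 0"
  shows "ratio1 r n p l u zeros v = (v / u) ^ n * exp (p * (u - v))
     - (u - v) / u ^ n * newton_form r n (\<lambda>z. exp (z * u)) (moment r n p v) l"
proof -
  have r: "r > 0" using u(1) by (auto intro: le_less_trans[OF norm_ge_zero])
  define c where "c = cramer n (dd_mat r l zeros) (dd_rhs r n p zeros v)"
  define s where "s w = (\<Sum>i<n. (w * p) ^ i / fact i)" for w
  define N where "N = newton_form r n (\<lambda>z. exp (z * u)) (moment r n p v) l"
  define e where "e = exp (- p * v)"
  have ee: "exp (v * p) * e = 1" unfolding e_def by (simp flip: exp_add)
  have mom: "(\<Sum>m<n. c m * l m ^ i) = moment r n p v i" if "i < n" for i
    unfolding c_def by (rule cramer_zeros_moments[OF assms(1) r that])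
  define T where "T = (\<Sum>j<n. u ^ j * (v ^ (n - Suc j) * (\<Sum>i<Suc j. (v * p) ^ i / fact i)))"
  have N: "(\<Sum>m<n. c m * exp (l m * u)) = N"
    unfolding N_def newton_form_def
    by (rule sum_eq_newton_form) (use mom assms in \<open>auto intro!: holomorphic_intros\<close>)
  \<comment> \<open>These Taylor polynomials have degree below \<open>n\<close> in l_m, so the
    weighted sum depends on the moments alone.\<close>
  have "(\<Sum>m<n. c m * (\<Sum>j<n. (u * l m) ^ j / fact j))
     = (\<Sum>j<n. u ^ j / fact j * (\<Sum>m<n. c m * l m ^ j))"
    unfolding sum_distrib_left by (subst sum.swap) (simp add: power_mult_distrib mult_ac)
  also have "\<dots> = (\<Sum>j<n. u ^ j * dd_rhs r n p zeros v j)"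
    by (intro sum.cong) (simp_all add: mom moment_def)
  also have "\<dots> = (\<Sum>j<n. - e * (u ^ j * (v ^ (n - Suc j) * (\<Sum>i<Suc j. (v * p) ^ i / fact i))))"
    by (intro sum.cong refl) (simp add: dd_rhs_zeros[OF v] e_def mult_ac del: sum.lessThan_Suc)
  also have "\<dots> = - e * T"
    unfolding T_def by (rule sum_distrib_left[symmetric])
  finally have T: "(\<Sum>m<n. c m * (\<Sum>j<n. (u * l m) ^ j / fact j)) = - e * T" .
  have "(\<Sum>m<n. c m * dde r (l m) (replicate n 0 @ [u]))
      = ((\<Sum>m<n. c m * exp (l m * u)) - (\<Sum>m<n. c m * (\<Sum>j<n. (u * l m) ^ j / fact j))) / u ^ n"
    unfolding dde_zeros_insert[OF u]
    by (simp add: sum_divide_distrib right_diff_distrib mult.commute flip: sum_subtractf)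
  also have "\<dots> = (N + e * T) / u ^ n" unfolding N T by simp
  finally have "(u - v) * (\<Sum>m<n. c m * dde r (l m) (replicate n 0 @ [u]))
     = ((u - v) * N + e * ((u - v) * T)) / u ^ n"
    by (simp add: algebra_simps)
  then have sum: "(u - v) * (\<Sum>m<n. c m * dde r (l m) (replicate n 0 @ [u]))
     = ((u - v) * N + e * (u ^ n * s v - v ^ n * s u)) / u ^ n"
    unfolding T_def s_def telescoping_exp_sums .
  have "ratio1 r n p l u zeros v = 1 + v ^ n * e * ((u - v) * dde r p (replicate n 0 @ [u, v]))
      - (u - v) * (\<Sum>m<n. c m * dde r (l m) (replicate n 0 @ [u]))"
    by (simp add: ratio1_def c_def e_def zeros_def mult_ac flip: map_zeros)
  also have "\<dots> = 1 + v ^ n * e * ((exp (u * p) - s u) / u ^ n - (exp (v * p) - s v) / v ^ n)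
      - ((u - v) * N + e * (u ^ n * s v - v ^ n * s u)) / u ^ n"
    by (simp only: sum dde_zeros_insert2[OF u(1) v(1)] dde_zeros_insert[OF u, where c = p]
          dde_zeros_insert[OF v, where c = p] s_def)
  \<comment> \<open>All terms with \<open>s\<close> cancel; the leading 1 will cancel against
    \<open>exp (v * p) * e\<close>.\<close>
  also have "\<dots> = 1 - exp (v * p) * e + (v / u) ^ n * (e * exp (u * p)) - (u - v) / u ^ n * N"
    using u(2) v(2) by (simp add: power_divide divide_simps) (simp add: algebra_simps)
  also have "e * exp (u * p) = exp (p * (u - v))"
    unfolding e_def by (simp add: algebra_simps flip: exp_add)
  finally show ?thesis by (simp add: ee N_def)
qed

section \<open>Limits in the parameters\<close>

lemma weyl_strict_imp_inj: "weyl_strict n l \<Longrightarrow> inj_on l {..<n}"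
  by (rule linorder_inj_onI') (force simp: weyl_strict_def)

text \<open>\<open>\<Phi>\<close> is the continuous extension to repeated coordinates of a formula
  valid in the open chamber near \<open>l\<close>. Continuity is asked for coordinatewise, along any
  filter.\<close>

lemma ratioB_eqI:
  assumes l: "weyl n l" and r: "\<And>i. i < n \<Longrightarrow> \<bar>l i\<bar> < r"
    and eq: "\<And>l'. weyl_strict n l' \<Longrightarrow> (\<And>i. i < n \<Longrightarrow> \<bar>l' i\<bar> < r) \<Longrightarrow> F l' / B n l' zeros = \<Phi> l'"
    and lim: "\<And>G. (\<And>i. ((\<lambda>l'. l' i) \<longlongrightarrow> l i) G) \<Longrightarrow> (\<Phi> \<longlongrightarrow> \<Phi> l) G"
  shows "ratioB n l F = \<Phi> l"
proof (cases "weyl_strict n l")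
  case True
  then show ?thesis using eq[OF True r] by (simp add: ratioB_def)
next
  case False
  let ?S = "{l'. weyl_strict n l' \<and> (\<forall>i\<ge>n. l' i = l i)}"
  have co: "((\<lambda>l'. l' i) \<longlongrightarrow> l i) (at l within ?S)" for i
    by (rule tendsto_funD[OF tendsto_ident_at])
  have "eventually (\<lambda>l'. \<forall>i\<in>{..<n}. \<bar>l' i\<bar> < r) (at l within ?S)"
    by (intro eventually_ball_finite ballI order_tendstoD(2)[OF tendsto_rabs[OF co]]) (use r in auto)
  then have "eventually (\<lambda>l'. \<Phi> l' = F l' / B n l' zeros) (at l within ?S)"
    unfolding eventually_at_filter by eventually_elim (auto simp: eq)
  with lim[OF co] have L: "((\<lambda>l'. F l' / B n l' zeros) \<longlongrightarrow> \<Phi> l) (at l within ?S)"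
    by (rule Lim_transform_eventually)
  have "at l within ?S \<noteq> bot"
  proof (rule at_within_nontrivial[where F = "at_right (0::real)"])
    \<comment> \<open>Lowering the \<open>i\<close>-th coordinate by a multiple of \<open>i\<close>
      moves a weakly decreasing vector into the open chamber.\<close>
    show "((\<lambda>\<epsilon> i. if i < n then l i - \<epsilon> * real i else l i) \<longlongrightarrow> l) (at_right (0::real))"
    proof (rule tendsto_funI)
      fix i
      have "((\<lambda>\<epsilon>. l i - \<epsilon> * real i) \<longlongrightarrow> l i - 0 * real i) (at_right (0::real))"
        by (intro tendsto_intros)
      then show "((\<lambda>\<epsilon>. if i < n then l i - \<epsilon> * real i else l i) \<longlongrightarrow> l i) (at_right (0::real))"
        by (cases "i < n") auto
    qed
    show "eventually (\<lambda>\<epsilon>. (\<lambda>i. if i < n then l i - \<epsilon> * real i else l i) \<in> ?S) (at_right 0)"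
      using eventually_at_right_less[of "0::real"]
    proof eventually_elim
      case (elim \<epsilon>)
      have "l j - \<epsilon> * real j < l i - \<epsilon> * real i" if "i < j" "j < n" for i j
      proof -
        have "l j \<le> l i" using l that by (auto simp: weyl_def)
        moreover have "\<epsilon> * real i < \<epsilon> * real j" using elim that by simp
        ultimately show ?thesis by linarith
      qed
      then show ?case by (auto simp: weyl_strict_def)
    qed
  qed (use False in auto)
  from tendsto_Lim[OF this L] show ?thesis using False by (simp add: ratioB_def)
qed

section \<open>The integral representation\<close>

text \<open>The fundamental theorem on the intervals from 0 to \<open>k\<close>, then dominated
  convergence with the exponential bound as majorant.\<close>

lemma has_integral_half_line_FTC:
  fixes f F :: "real \<Rightarrow> complex"
  assumes F: "\<And>t. t \<ge> 0 \<Longrightarrow> (F has_vector_derivative f t) (at t within {0..})"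
    and lim: "(F \<longlongrightarrow> 0) at_top" and b: "b > 0"
    and bound: "\<And>t. t \<ge> 0 \<Longrightarrow> norm (f t) \<le> C * exp (- b * t)"
  shows "(f has_integral - F 0) {0..}"
proof (rule has_integral_dominated_convergence)
  fix k :: nat
  have "(f has_integral (F (real k) - F 0)) {0..real k}"
    by (rule fundamental_theorem_of_calculus) (auto intro: has_vector_derivative_within_subset[OF F])
  then have "((\<lambda>t. if t \<in> {0..real k} then f t else 0) has_integral (F (real k) - F 0)) UNIV"
    by (simp only: has_integral_restrict_UNIV)
  then have "((\<lambda>t. if t \<in> {0..} then if t \<in> {0..real k} then f t else 0 else 0)
      has_integral (F (real k) - F 0)) UNIV"
    by (rule has_integral_eq[rotated]) auto
  then show "((\<lambda>t. if t \<in> {0..real k} then f t else 0) has_integral (F (real k) - F 0)) {0..}"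
    by (simp only: has_integral_restrict_UNIV)
next
  show "(\<lambda>t. C * exp (- b * t)) integrable_on {0..}"
    using integrable_on_exp_minus_to_infinity[OF b] by (intro integrable_on_mult_right)
next
  fix k
  have C: "0 \<le> C" using bound[of 0] norm_ge_zero[of "f 0"] by (simp del: norm_ge_zero)
  show "\<forall>t\<in>{0..}. norm (if t \<in> {0..real k} then f t else 0) \<le> C * exp (- b * t)"
    using bound C by auto
next
  show "\<forall>t\<in>{0..}. (\<lambda>k. if t \<in> {0..real k} then f t else 0) \<longlonglongrightarrow> f t"
  proof
    fix t :: real assume "t \<in> {0..}"
    have "eventually (\<lambda>k. t \<le> real k) sequentially"
      using filterlim_real_sequentially by (simp add: filterlim_at_top)
    then have "eventually (\<lambda>k. (if t \<in> {0..real k} then f t else 0) = f t) sequentially"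
      by eventually_elim (use \<open>t \<in> {0..}\<close> in simp)
    then show "(\<lambda>k. if t \<in> {0..real k} then f t else 0) \<longlonglongrightarrow> f t"
      by (rule tendsto_eventually)
  qed
next
  have "(\<lambda>k. F (real k)) \<longlonglongrightarrow> 0"
    by (rule filterlim_compose[OF lim filterlim_real_sequentially])
  then have "(\<lambda>k. F (real k) - F 0) \<longlonglongrightarrow> 0 - F 0"
    by (intro tendsto_intros)
  then show "(\<lambda>k. F (real k) - F 0) \<longlonglongrightarrow> - F 0" by simp
qed

lemma power_le_exp:
  fixes b :: real
  assumes "b > 0"
  obtains C where "\<And>t. t \<ge> 0 \<Longrightarrow> (1 + t) ^ i \<le> C * exp (b * t)"
proof (cases "i = 0")
  case True
  then show ?thesis using assms by (intro that[of 1]) auto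
next
  case False
  show ?thesis
  \<comment> \<open>From (1 + x/i)^i <= e^x with x = b (1 + t); the factor e^b is due to the shift
    of \<open>t\<close> by 1.\<close>
  proof (rule that[of "(i / b) ^ i * exp b"])
    fix t :: real assume t: "t \<ge> 0"
    have "(b * (1 + t) / i) ^ i \<le> (1 + b * (1 + t) / i) ^ i"
      using assms t by (intro power_mono) auto
    also have "\<dots> \<le> exp (b * (1 + t))"
      using assms t False by (intro exp_ge_one_plus_x_over_n_power_n)
        (auto intro: order_trans[of _ 0])
    finally have "(i / b) ^ i * (b * (1 + t) / i) ^ i \<le> (i / b) ^ i * exp (b * (1 + t))"
      using assms by (intro mult_left_mono) auto
    also have "(i / b) ^ i * (b * (1 + t) / i) ^ i = (1 + t) ^ i"
      using assms False by (simp flip: power_mult_distrib)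
    finally show "(1 + t) ^ i \<le> (i / b) ^ i * exp b * exp (b * t)"
      by (simp add: distrib_left exp_add mult_ac)
  qed
qed

text \<open>The exponential decays at the rate \<open>Re (d * v)\<close>; half of the rate absorbs
  the polynomial growth and the other half remains.\<close>

lemma exp_power_ray_bound:
  assumes "Re (d * v) > 0"
  obtains C where "\<And>t. t \<ge> 0 \<Longrightarrow> norm (exp (- ((p + of_real t * d) * v)) * (p + of_real t * d) ^ i)
      \<le> C * exp (- (Re (d * v) / 2) * t)"
proof -
  define b where "b = Re (d * v) / 2"
  obtain C where C: "\<And>t. t \<ge> 0 \<Longrightarrow> (1 + t) ^ i \<le> C * exp (b * t)"
    using power_le_exp[of b] assms by (auto simp: b_def)
  define A where "A = norm p + norm d"
  show ?thesis
  proof (rule that[of "exp (- Re (p * v)) * (A ^ i * C)"])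
    fix t :: real assume t: "t \<ge> 0"
    have "norm (p + of_real t * d) \<le> norm p + t * norm d"
      using norm_triangle_ineq[of p "of_real t * d"] t by (simp add: norm_mult)
    also have "\<dots> \<le> A * (1 + t)"
      using t by (simp add: A_def algebra_simps)
    finally have "norm (p + of_real t * d) ^ i \<le> (A * (1 + t)) ^ i"
      by (rule power_mono) simp
    also have "\<dots> \<le> A ^ i * (C * exp (b * t))"
      unfolding power_mult_distrib using C[OF t] by (intro mult_left_mono) (auto simp: A_def)
    finally have "norm (p + of_real t * d) ^ i \<le> A ^ i * (C * exp (b * t))" .
    moreover have "Re (- ((p + of_real t * d) * v)) = - Re (p * v) - t * (2 * b)"
    proof -
      have "2 * b = Re (d * v)" by (simp add: b_def)
      then show ?thesis by (simp only:) (simp add: algebra_simps)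
    qed
    ultimately have "norm (exp (- ((p + of_real t * d) * v)) * (p + of_real t * d) ^ i)
        \<le> exp (- Re (p * v) - t * (2 * b)) * (A ^ i * (C * exp (b * t)))"
      unfolding norm_mult norm_power norm_exp_eq_Re by (simp only:) (rule mult_left_mono, auto)
    also have "exp (- Re (p * v) - t * (2 * b)) = exp (- Re (p * v)) * (exp (- b * t) * exp (- b * t))"
      by (simp flip: exp_add)
    also have "exp (- Re (p * v)) * (exp (- b * t) * exp (- b * t)) * (A ^ i * (C * exp (b * t)))
        = exp (- Re (p * v)) * (A ^ i * C) * exp (- b * t) * (exp (- b * t) * exp (b * t))"
      by (simp only: mult_ac)
    also have "exp (- b * t) * exp (b * t) = 1" by (simp flip: exp_add)
    finally show "norm (exp (- ((p + of_real t * d) * v)) * (p + of_real t * d) ^ i)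
        \<le> exp (- Re (p * v)) * (A ^ i * C) * exp (- (Re (d * v) / 2) * t)"
      by (simp add: b_def)
  qed
qed

lemma has_integral_exp_power_ray:
  fixes p d v :: complex
  assumes dv: "Re (d * v) > 0"
  defines "w \<equiv> \<lambda>t. p + of_real t * d"
  shows "((\<lambda>t. d * (exp (- (w t * v)) * w t ^ i)) has_integral
     fact i * (exp (- p * v) * (\<Sum>j<Suc i. (v * p) ^ j / fact j)) / v ^ Suc i) {0..}"
proof -
  have v: "v \<noteq> 0" using dv by auto
  \<comment> \<open>The antiderivative of w^i e^{-wv} along the ray that vanishes at infinity, as in
    an incomplete gamma function.\<close>
  define F where "F t = - (fact i * (exp (- (w t * v)) * (\<Sum>j<Suc i. (v * w t) ^ j / fact j)) / v ^ Suc i)" for t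
  define b where "b = Re (d * v) / 2"
  obtain C where C: "\<And>t. t \<ge> 0 \<Longrightarrow> norm (exp (- (w t * v)) * w t ^ i) \<le> C * exp (- b * t)"
    using exp_power_ray_bound[OF dv] unfolding w_def b_def by blast
  have "((\<lambda>t. d * (exp (- (w t * v)) * w t ^ i)) has_integral - F 0) {0..}"
  proof (rule has_integral_half_line_FTC)
    have zero: "((\<lambda>t. exp (- (w t * v)) * w t ^ j) \<longlongrightarrow> 0) at_top" for j
    proof -
      obtain C' where C': "\<And>t. t \<ge> 0 \<Longrightarrow> norm (exp (- (w t * v)) * w t ^ j) \<le> C' * exp (- b * t)"
        using exp_power_ray_bound[OF dv] unfolding w_def b_def by blast
      have "eventually (\<lambda>t. norm (exp (- (w t * v)) * w t ^ j) \<le> C' * exp (- b * t)) at_top"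
        using eventually_ge_at_top[of 0] by eventually_elim (rule C')
      moreover have "((\<lambda>t. C' * exp (- b * t)) \<longlongrightarrow> 0) at_top"
        using dv by (intro tendsto_mult_right_zero filterlim_compose[OF exp_at_bot]
            filterlim_tendsto_neg_mult_at_bot[OF tendsto_const _ filterlim_ident]) (auto simp: b_def)
      ultimately show ?thesis by (rule Lim_null_comparison)
    qed
    have "((\<lambda>t. - (fact i / v ^ Suc i * (\<Sum>j<Suc i. v ^ j / fact j * (exp (- (w t * v)) * w t ^ j))))
        \<longlongrightarrow> - (fact i / v ^ Suc i * (\<Sum>j<Suc i. v ^ j / fact j * 0))) at_top"
      by (intro tendsto_intros zero)
    then show "(F \<longlongrightarrow> 0) at_top"
      by (simp add: F_def[abs_def] sum_distrib_left power_mult_distrib mult_ac divide_inverse del: sum.lessThan_Suc)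
    \<comment> \<open>The derivative telescopes: each Taylor term is cancelled by the next one, and
      only the last survives.\<close>
    have der: "((\<lambda>x. exp (- (x * v)) * (\<Sum>j<Suc m. (v * x) ^ j / fact j)) has_field_derivative
         - (v * (exp (- (x * v)) * ((v * x) ^ m / fact m)))) (at x)" for x m
    proof (induction m)
      case 0
      show ?case by (auto intro!: derivative_eq_intros)
    next
      case (Suc m)
      have "((\<lambda>x. exp (- (x * v)) * ((v * x) ^ Suc m / fact (Suc m))) has_field_derivative
          v * (exp (- (x * v)) * ((v * x) ^ m / fact m)) - v * (exp (- (x * v)) * ((v * x) ^ Suc m / fact (Suc m)))) (at x)"
      proof -
        have q: "((\<lambda>x. (v * x) ^ Suc m / fact (Suc m)) has_field_derivative v * ((v * x) ^ m / fact m)) (at x)"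
        proof -
          have "((\<lambda>x. (v * x) ^ Suc m / fact (Suc m)) has_field_derivative
              of_nat (Suc m) * (v * x) ^ m * v / fact (Suc m)) (at x)"
          proof -
            have "((\<lambda>x. v * x) has_field_derivative v) (at x)"
              by (auto intro!: derivative_eq_intros)
            from DERIV_cdivide[OF DERIV_power[OF this, of "Suc m"], of "fact (Suc m)"]
            show ?thesis by (rule DERIV_cong) (simp add: mult_ac del: of_nat_Suc fact_Suc)
          qed
          also have "of_nat (Suc m) * (v * x) ^ m * v / fact (Suc m) = v * ((v * x) ^ m / fact m)"
            by (simp add: fact_Suc field_simps del: of_nat_Suc)
          finally show ?thesis .
        qed
        have "((\<lambda>x. exp (- (x * v))) has_field_derivative - (v * exp (- (x * v)))) (at x)"
          by (auto intro!: derivative_eq_intros)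
        from DERIV_mult[OF this q] show ?thesis
          by (rule DERIV_cong) (simp add: algebra_simps)
      qed
      from DERIV_add[OF Suc this] show ?case
        by (subst sum.lessThan_Suc) (simp add: distrib_left algebra_simps del: sum.lessThan_Suc)
    qed
    show "(F has_vector_derivative d * (exp (- (w t * v)) * w t ^ i)) (at t within {0..})" for t
    proof -
      have 1: "(w has_vector_derivative d) (at t within {0..})"
        unfolding w_def by (auto intro!: derivative_eq_intros)
      have "((\<lambda>x. - (fact i * (exp (- (x * v)) * (\<Sum>j<Suc i. (v * x) ^ j / fact j)) / v ^ Suc i))
          has_field_derivative - (fact i * (- (v * (exp (- (w t * v)) * ((v * w t) ^ i / fact i)))) / v ^ Suc i)) (at (w t))"
        by (intro DERIV_minus DERIV_cdivide DERIV_cmult der)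
      also have "- (fact i * (- (v * (exp (- (w t * v)) * ((v * w t) ^ i / fact i)))) / v ^ Suc i)
          = exp (- (w t * v)) * w t ^ i"
        using v by (simp add: power_mult_distrib)
      finally have "(((\<lambda>x. - (fact i * (exp (- (x * v)) * (\<Sum>j<Suc i. (v * x) ^ j / fact j)) / v ^ Suc i)) \<circ> w)
         has_vector_derivative d * (exp (- (w t * v)) * w t ^ i)) (at t within {0..})"
        by (rule field_vector_diff_chain_within[OF 1 has_field_derivative_at_within])
      then show ?thesis by (simp add: F_def[abs_def] o_def del: sum.lessThan_Suc)
    qed
    show "b > 0" using dv by (simp add: b_def)
    show "norm (d * (exp (- (w t * v)) * w t ^ i)) \<le> norm d * C * exp (- b * t)" if "t \<ge> 0" for t
      unfolding norm_mult[of d] mult.assoc using C[OF that] by (intro mult_left_mono) auto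
  qed
  then show ?thesis by (simp add: F_def w_def)
qed

text \<open>Up to the factor - v^n, the functional with these moments is integration against e^{-wv}
  along the ray. The base case compares the ray integrals with \<open>dd_rhs_zeros\<close>; the
  induction follows the recursion of \<open>newton_functional\<close>.\<close>

lemma has_integral_newton_functional:
  fixes p d v :: complex
  assumes dv: "Re (d * v) > 0" and r: "norm v < r" and "m + i < n"
  defines "w \<equiv> \<lambda>t. p + of_real t * d"
  shows "((\<lambda>t. d * (exp (- (w t * v)) * (w t ^ i * (\<Prod>j<m. w t - l j)))) has_integral
      - newton_functional (moment r n p v) l m i / v ^ n) {0..}"
  using assms(3)
proof (induction m arbitrary: i)
  case 0
  have v: "v \<noteq> 0" using dv by auto
  have "v ^ n = v ^ (n - Suc i) * v ^ Suc i"
    using 0 power_add[of v "n - Suc i" "Suc i"] by simp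
  then have "- moment r n p v i / v ^ n
     = fact i * (exp (- p * v) * (\<Sum>j<Suc i. (v * p) ^ j / fact j)) / v ^ Suc i"
    unfolding moment_def using dd_rhs_zeros[OF r v, of i n p] 0 v
    by (simp del: sum.lessThan_Suc power_Suc)
  then show ?case
    using has_integral_exp_power_ray[OF dv, of p i] by (simp add: w_def del: sum.lessThan_Suc)
next
  case (Suc m)
  let ?f = "\<lambda>m i t. d * (exp (- (w t * v)) * (w t ^ i * (\<Prod>j<m. w t - l j)))"
  have "((\<lambda>t. ?f m (Suc i) t - l m * ?f m i t) has_integral
      (- newton_functional (moment r n p v) l m (Suc i) / v ^ n
        - l m * (- newton_functional (moment r n p v) l m i / v ^ n))) {0..}"
    by (intro has_integral_diff has_integral_mult_right Suc.IH) (use Suc.prems in auto)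
  moreover have "(\<lambda>t. ?f m (Suc i) t - l m * ?f m i t) = ?f (Suc m) i"
    by (simp add: fun_eq_iff algebra_simps)
  moreover have "- newton_functional (moment r n p v) l m (Suc i) / v ^ n
        - l m * (- newton_functional (moment r n p v) l m i / v ^ n)
      = - newton_functional (moment r n p v) l (Suc m) i / v ^ n"
    by (simp add: diff_divide_distrib)
  ultimately show ?case by simp
qed

text \<open>The ray is connected, unbounded and disjoint from the path, so it lies in an unbounded
  component of the complement.\<close>

lemma winding_number_ray:
  assumes "path g" "pathfinish g = pathstart g" "d \<noteq> 0" "t \<ge> 0"
    and "path_image g \<inter> {p + of_real t * d | t. t \<ge> 0} = {}"
  shows "winding_number g (p + of_real t * d) = 0"
proof (rule winding_number_zero_in_outside[OF assms(1,2)])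
  define R where "R = {p + of_real t * d | t. t \<ge> (0::real)}"
  have R: "R = (\<lambda>t. p + of_real t * d) ` {0..}" by (auto simp: R_def)
  have sub: "R \<subseteq> connected_component_set (- path_image g) (p + of_real t * d)"
  proof (rule connected_component_maximal)
    show "p + of_real t * d \<in> R" using assms(4) by (auto simp: R_def)
    show "connected R" unfolding R by (intro connected_continuous_image continuous_intros) auto
    show "R \<subseteq> - path_image g" using assms(5) by (auto simp: R_def)
  qed
  have "\<not> bounded R"
  proof
    assume "bounded R"
    then obtain K where K: "\<And>z. z \<in> R \<Longrightarrow> norm z \<le> K" by (auto simp: bounded_iff)
    \<comment> \<open>Chosen so that the displacement along the ray has length |K| + |p| + 1, too
      large for a point of norm at most \<open>K\<close>.\<close>
    define s where "s = (\<bar>K\<bar> + norm p + 1) / norm d"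
    have s: "s \<ge> 0" by (simp add: s_def)
    have "norm (of_real s * d) = s * norm d" using s by (simp add: norm_mult)
    also have "\<dots> = \<bar>K\<bar> + norm p + 1" using assms(3) by (simp add: s_def)
    finally have "norm (of_real s * d) = \<bar>K\<bar> + norm p + 1" .
    moreover have "norm (of_real s * d) \<le> norm (p + of_real s * d) + norm p"
      using norm_triangle_ineq4[of "p + of_real s * d" p] by simp
    moreover have "norm (p + of_real s * d) \<le> K" using s by (intro K) (auto simp: R_def)
    ultimately show False by linarith
  qed
  then have "\<not> bounded (connected_component_set (- path_image g) (p + of_real t * d))"
    using sub bounded_subset by blast
  moreover have "p + of_real t * d \<notin> path_image g" using assms(4,5) by auto
  ultimately show "p + of_real t * d \<in> outside (path_image g)"
    by (simp add: outside_def)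
qed

section \<open>The determinantal formula and the integral representation\<close>

theorem theorem1p7:
  fixes N k :: nat and l :: "nat \<Rightarrow> real" and p :: complex
  assumes hl: "weyl N l"
    and hp: "\<forall>i<N. p \<noteq> of_real (l i)"
  shows
   "(\<forall>u v :: nat \<Rightarrow> complex.
       inj_on (\<lambda>x. case x of Inl i \<Rightarrow> u i | Inr j \<Rightarrow> v j) ({..<k} <+> {..<k}) \<longrightarrow>
       ratioB N l (\<lambda>l'. Bp N k l' p (\<lambda>i. if i < k then u i else 0) v)
       = (\<Prod>i<k. \<Prod>j<k. (u i - v j))
         / (\<Prod>(i,j) \<in> {(i,j). i < j \<and> j < k}. (u i - u j) * (v j - v i))
         * detn k (\<lambda>i j. 1 / (u i - v j) *
              ratioB N l (\<lambda>l'. Bp N 1 l' p (\<lambda>a. if a = 0 then u i else 0)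
                                           (\<lambda>b. if b = 0 then v j else 0))))
    \<and>
    (\<forall>(u::complex) (v::complex) (d::complex) (\<gamma>::real \<Rightarrow> complex).
       u \<noteq> 0 \<longrightarrow> v \<noteq> 0 \<longrightarrow> u \<noteq> v \<longrightarrow>
       valid_path \<gamma> \<longrightarrow> pathfinish \<gamma> = pathstart \<gamma> \<longrightarrow>
       (\<forall>i<N. of_real (l i) \<notin> path_image \<gamma> \<and> winding_number \<gamma> (of_real (l i)) = 1) \<longrightarrow>
       d \<noteq> 0 \<longrightarrow> Re (d * v) > 0 \<longrightarrow>
       path_image \<gamma> \<inter> {p + of_real t * d | t. t \<ge> 0} = {} \<longrightarrow>
       (let G = (\<lambda>t::real. let w = p + of_real t * d in
                   d * (contour_integral \<gamma>
                     (\<lambda>z. 1 / (w - z) * exp (z * u) / exp (w * v)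
                          * (\<Prod>i<N. (w - of_real (l i)) / (z - of_real (l i))))
                        / (2 * of_real pi * \<i>)))
        in G integrable_on {0..} \<and>
           ratioB N l (\<lambda>l'. Bp N 1 l' p (\<lambda>a. if a = 0 then u else 0)
                                        (\<lambda>b. if b = 0 then v else 0))
           = (u - v) * (v / u) ^ N * (exp (p * (u - v)) / (u - v) + integral {0..} G)))"
proof (intro conjI allI impI)
  fix u v :: "nat \<Rightarrow> complex"
  assume inj: "inj_on (\<lambda>x. case x of Inl i \<Rightarrow> u i | Inr j \<Rightarrow> v j) ({..<k} <+> {..<k})"
  have inju: "inj_on u {..<k}"
  proof (rule inj_onI)
    fix i j assume "i \<in> {..<k}" "j \<in> {..<k}" "u i = u j"
    then show "i = j" using inj_onD[OF inj, of "Inl i" "Inl j"] by auto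
  qed
  have injv: "inj_on v {..<k}"
  proof (rule inj_onI)
    fix i j assume "i \<in> {..<k}" "j \<in> {..<k}" "v i = v j"
    then show "i = j" using inj_onD[OF inj, of "Inr i" "Inr j"] by auto
  qed
  have uv: "u i \<noteq> v j" if "i < k" "j < k" for i j
    using inj_onD[OF inj, of "Inl i" "Inr j"] that by auto
  \<comment> \<open>One radius exceeding all arguments and parameters, since divided differences are
    taken both in the arguments and in \<open>l\<close>.\<close>
  define r where "r = 1 + (\<Sum>i<k. norm (u i)) + (\<Sum>j<k. norm (v j)) + (\<Sum>i<N. \<bar>l i\<bar>)"
  have nn: "0 \<le> (\<Sum>i<k. norm (u i))" "0 \<le> (\<Sum>i<k. norm (v i))" "0 \<le> (\<Sum>i<N. \<bar>l i\<bar>)"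
    by (auto intro: sum_nonneg)
  have r: "r > 0" using nn unfolding r_def by linarith
  have ru: "norm (u i) < r" if "i < k" for i
  proof -
    have "norm (u i) \<le> (\<Sum>i<k. norm (u i))" by (rule member_le_sum) (use that in auto)
    then show ?thesis using nn unfolding r_def by linarith
  qed
  have rv: "norm (v i) < r" if "i < k" for i
  proof -
    have "norm (v i) \<le> (\<Sum>i<k. norm (v i))" by (rule member_le_sum) (use that in auto)
    then show ?thesis using nn unfolding r_def by linarith
  qed
  have rl: "\<bar>l i\<bar> < r" if "i < N" for i
  proof -
    have "\<bar>l i\<bar> \<le> (\<Sum>i<N. \<bar>l i\<bar>)" by (rule member_le_sum) (use that in auto)
    then show ?thesis using nn unfolding r_def by linarith
  qed
  \<comment> \<open>The expression of \<open>ratio1_zeros\<close> as a function of the parameters,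
    free of denominators that vanish when they coincide.\<close>
  define \<Phi> where "\<Phi> a b l' = 1
     + (a - b) * (b ^ N * exp (- p * b) * dde r p (replicate N 0 @ [a, b]))
     - (a - b) * newton_form r N (\<lambda>c. dde r c (replicate N 0 @ [a])) (moment r N p b) (\<lambda>i. of_real (l' i))"
    for a b and l' :: "nat \<Rightarrow> real"
  have \<Phi>: "ratio1 r N p (\<lambda>m. of_real (l' m)) (u i) zeros (v j) = \<Phi> (u i) (v j) l'"
    if "i < k" "j < k" "weyl_strict N l'" "\<And>i. i < N \<Longrightarrow> \<bar>l' i\<bar> < r" for i j l'
    unfolding \<Phi>_def
    by (rule ratio1_zeros) (use that ru weyl_strict_imp_inj[OF that(3)] in \<open>auto simp: inj_on_def\<close>)
  have lim: "(\<Phi> (u i) (v j) \<longlongrightarrow> \<Phi> (u i) (v j) l) G"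
    if "i < k" "\<And>i. ((\<lambda>l'. l' i) \<longlongrightarrow> l i) G" for G i j
    unfolding \<Phi>_def
    by (intro tendsto_intros tendsto_newton_form tendsto_of_real that dde_zeros_holomorphic ru)
       (use rl r in auto)
  have 1: "ratioB N l (\<lambda>l'. Bp N 1 l' p (\<lambda>a. if a = 0 then u i else 0) (\<lambda>b. if b = 0 then v j else 0))
      = \<Phi> (u i) (v j) l" if ij: "i < k" "j < k" for i j
  proof (rule ratioB_eqI[OF hl rl])
    fix l' assume l': "weyl_strict N l'" "\<And>i. i < N \<Longrightarrow> \<bar>l' i\<bar> < r"
    have "Bp N 1 l' p (\<lambda>a. if a = 0 then u i else 0) (\<lambda>b. if b = 0 then v j else 0) / B N l' zeros
        = ratio1 r N p (\<lambda>m. of_real (l' m)) (u i) zeros (v j)"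
      by (rule Bp1_over_B_zeros) (use ij uv ru rv weyl_strict_imp_inj[OF l'(1)] in auto)
    also have "\<dots> = \<Phi> (u i) (v j) l'" by (rule \<Phi>[OF ij l'])
    finally show "Bp N 1 l' p (\<lambda>a. if a = 0 then u i else 0) (\<lambda>b. if b = 0 then v j else 0) / B N l' zeros
        = \<Phi> (u i) (v j) l'" .
  qed (use lim ij in auto)
  define \<Psi> where "\<Psi> l' = (\<Prod>i<k. \<Prod>j<k. (u i - v j))
         / (\<Prod>(i,j) \<in> {(i,j). i < j \<and> j < k}. (u i - u j) * (v j - v i))
         * detn k (\<lambda>i j. 1 / (u i - v j) * \<Phi> (u i) (v j) l')" for l'
  have "ratioB N l (\<lambda>l'. Bp N k l' p (\<lambda>i. if i < k then u i else 0) v) = \<Psi> l"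
  proof (rule ratioB_eqI[OF hl rl])
    fix l' assume l': "weyl_strict N l'" "\<And>i. i < N \<Longrightarrow> \<bar>l' i\<bar> < r"
    have "detn k (\<lambda>i j. 1 / (u i - v j) * \<Phi> (u i) (v j) l')
        = detn k (\<lambda>i j. 1 / (u i - v j) * ratio1 r N p (\<lambda>m. of_real (l' m)) (u i) zeros (v j))"
      by (rule detn_cong) (simp add: \<Phi> l')
    then show "Bp N k l' p (\<lambda>i. if i < k then u i else 0) v / B N l' zeros = \<Psi> l'"
      unfolding \<Psi>_def
      by (simp only:)
         (rule Bp_over_B_zeros[OF inju injv uv ru rv r weyl_strict_imp_inj[OF l'(1)]])
  next
    fix G :: "(nat \<Rightarrow> real) filter" assume "\<And>i. ((\<lambda>l'. l' i) \<longlongrightarrow> l i) G"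
    then show "(\<Psi> \<longlongrightarrow> \<Psi> l) G"
      unfolding \<Psi>_def by (intro tendsto_mult tendsto_const tendsto_detn lim)
  qed
  also have "\<Psi> l = (\<Prod>i<k. \<Prod>j<k. (u i - v j))
         / (\<Prod>(i,j) \<in> {(i,j). i < j \<and> j < k}. (u i - u j) * (v j - v i))
         * detn k (\<lambda>i j. 1 / (u i - v j) *
              ratioB N l (\<lambda>l'. Bp N 1 l' p (\<lambda>a. if a = 0 then u i else 0)
                                           (\<lambda>b. if b = 0 then v j else 0)))"
    unfolding \<Psi>_def by (intro arg_cong2[where f = "(*)"] refl detn_cong) (simp only: 1)
  finally show "ratioB N l (\<lambda>l'. Bp N k l' p (\<lambda>i. if i < k then u i else 0) v) = \<dots>" .
next
  fix u v d :: complex and \<gamma> :: "real \<Rightarrow> complex"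
  assume u: "u \<noteq> 0" and v: "v \<noteq> 0" and uv: "u \<noteq> v"
    and \<gamma>: "valid_path \<gamma>" "pathfinish \<gamma> = pathstart \<gamma>"
    and wl: "\<forall>i<N. of_real (l i) \<notin> path_image \<gamma> \<and> winding_number \<gamma> (of_real (l i)) = 1"
    and d: "d \<noteq> 0" and dv: "Re (d * v) > 0"
    and ray: "path_image \<gamma> \<inter> {p + of_real t * d | t. t \<ge> 0} = {}"
  define r where "r = 1 + norm u + norm v + (\<Sum>i<N. \<bar>l i\<bar>)"
  have nn: "0 \<le> (\<Sum>i<N. \<bar>l i\<bar>)" by (auto intro: sum_nonneg)
  have r: "r > 0" "norm u < r" "norm v < r" using nn by (auto simp: r_def add_nonneg_pos add_pos_nonneg)
  have rl: "\<bar>l i\<bar> < r" if "i < N" for i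
  proof -
    have "\<bar>l i\<bar> \<le> (\<Sum>i<N. \<bar>l i\<bar>)" by (rule member_le_sum) (use that in auto)
    then show ?thesis using norm_ge_zero[of u] norm_ge_zero[of v] unfolding r_def by linarith
  qed
  define L where "L i = complex_of_real (l i)" for i
  \<comment> \<open>The integral of e^{-wv} times the \<open>m\<close>-th Newton basis polynomial
    along the ray.\<close>
  define X where "X m = - newton_functional (moment r N p v) L m 0 / v ^ N" for m
  define G where "G = (\<lambda>t::real. let w = p + of_real t * d in
                   d * (contour_integral \<gamma>
                     (\<lambda>z. 1 / (w - z) * exp (z * u) / exp (w * v)
                          * (\<Prod>i<N. (w - of_real (l i)) / (z - of_real (l i))))
                        / (2 * of_real pi * \<i>)))"
  have hol: "(\<lambda>z. exp (z * u)) holomorphic_on UNIV" by (intro holomorphic_intros)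
  have circ: "ddc \<gamma> (\<lambda>z. exp (z * u)) (map L [0..<Suc m]) = dde r u (map L [0..<Suc m])" if m: "m < N" for m
  proof (rule ddc_path_independent[OF hol \<gamma>])
    fix y assume "y \<in> set (map L [0..<Suc m])"
    then obtain i where "i < Suc m" "y = L i" by (auto simp del: upt_Suc)
    with m have i: "i < N" "y = L i" by auto
    show "y \<notin> path_image \<gamma> \<and> winding_number \<gamma> y = 1" using wl i by (simp add: L_def)
    show "y \<notin> path_image (circlepath 0 r) \<and> winding_number (circlepath 0 r) y = 1"
      using rl[OF i(1)] r(1) i(2) by (auto simp: L_def path_image_circlepath_nonneg winding_number_circlepath)
  qed auto
  have G_eq: "G t = (\<Sum>m<N. dde r u (map L [0..<Suc m]) *
      (d * (exp (- ((p + of_real t * d) * v)) * ((p + of_real t * d) ^ 0 * (\<Prod>j<m. (p + of_real t * d) - L j)))))"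
    if t: "t \<ge> 0" for t
  proof -
    define w where "w = p + of_real t * d"
    have off: "w \<notin> path_image \<gamma>" "\<And>i. i < N \<Longrightarrow> L i \<notin> path_image \<gamma>"
      using ray t wl by (auto simp: w_def L_def)
    \<comment> \<open>Points of the ray have winding number 0, so the left side of
      \<open>ddc_newton\<close> vanishes and the remainder is minus the Newton polynomial of e^{zu}
      at \<open>w\<close>.\<close>
    have "ddc \<gamma> (\<lambda>z. exp (z * u)) [w] = 0"
      using ddc_single[OF hol \<gamma> off(1)] winding_number_ray[OF valid_path_imp_path[OF \<gamma>(1)] \<gamma>(2) d t ray]
      by (simp add: w_def)
    then have newton: "(\<Sum>m<N. ddc \<gamma> (\<lambda>z. exp (z * u)) (map L [0..<Suc m]) * (\<Prod>i<m. w - L i))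
           = - ((\<Prod>i<N. w - L i) * ddc \<gamma> (\<lambda>z. exp (z * u)) (w # map L [0..<N]))"
      using ddc_newton[OF hol \<gamma>(1) off(1), of N L] off(2) by (simp add: eq_neg_iff_add_eq_0 del: upt_Suc)
    have int: "(\<lambda>z. exp (z * u) / (\<Prod>y\<leftarrow>w # map L [0..<N]. z - y)) contour_integrable_on \<gamma>"
      by (rule ddc_integrable[OF hol \<gamma>(1)]) (use off in auto)
    \<comment> \<open>Up to a factor independent of \<open>z\<close>, the integrand is that of the
      Newton remainder. The equality holds for every \<open>z\<close>: at the poles both sides are 0
      by the convention for division by zero.\<close>
    have "(\<lambda>z. 1 / (w - z) * exp (z * u) / exp (w * v) * (\<Prod>i<N. (w - of_real (l i)) / (z - of_real (l i))))
        = (\<lambda>z. - (exp (- (w * v)) * (\<Prod>i<N. w - L i)) * (exp (z * u) / (\<Prod>y\<leftarrow>w # map L [0..<N]. z - y)))"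
    proof
      fix z
      have 1: "(\<Prod>y\<leftarrow>w # map L [0..<N]. z - y) = (z - w) * (\<Prod>i<N. z - L i)"
        using prod.distinct_set_conv_list[of "[0..<N]" "\<lambda>i. z - L i"]
        by (simp add: o_def atLeast0LessThan)
      have 2: "1 / (w - z) = - (1 / (z - w))" by (metis minus_diff_eq minus_divide_right)
      have 3: "(\<Prod>i<N. (w - of_real (l i)) / (z - of_real (l i))) = (\<Prod>i<N. w - L i) / (\<Prod>i<N. z - L i)"
        by (simp add: L_def prod_dividef)
      show "1 / (w - z) * exp (z * u) / exp (w * v) * (\<Prod>i<N. (w - of_real (l i)) / (z - of_real (l i)))
        = - (exp (- (w * v)) * (\<Prod>i<N. w - L i)) * (exp (z * u) / (\<Prod>y\<leftarrow>w # map L [0..<N]. z - y))"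
        unfolding 1 2 3 by (simp add: exp_minus divide_inverse mult_ac)
    qed
    then have "G t = d * (exp (- (w * v)) * (- ((\<Prod>i<N. w - L i) * ddc \<gamma> (\<lambda>z. exp (z * u)) (w # map L [0..<N]))))"
      unfolding G_def Let_def w_def[symmetric]
      by (simp only: contour_integral_lmul[OF int]) (simp add: ddc_def)
    also have "\<dots> = d * (exp (- (w * v)) * (\<Sum>m<N. dde r u (map L [0..<Suc m]) * (\<Prod>i<m. w - L i)))"
      unfolding newton[symmetric] by (simp add: circ del: upt_Suc)
    finally show ?thesis
      by (simp add: sum_distrib_left mult_ac w_def del: upt_Suc)
  qed
  have "((\<lambda>t. \<Sum>m<N. dde r u (map L [0..<Suc m]) *
      (d * (exp (- ((p + of_real t * d) * v)) * ((p + of_real t * d) ^ 0 * (\<Prod>j<m. (p + of_real t * d) - L j)))))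
      has_integral (\<Sum>m<N. dde r u (map L [0..<Suc m]) * X m)) {0..}"
    unfolding X_def
    by (intro has_integral_sum has_integral_mult_right has_integral_newton_functional dv r) auto
  then have "(G has_integral (\<Sum>m<N. dde r u (map L [0..<Suc m]) * X m)) {0..}"
    by (rule has_integral_eq[rotated]) (simp add: G_eq del: upt_Suc)
  moreover have "(\<Sum>m<N. dde r u (map L [0..<Suc m]) * X m)
      = - newton_form r N (\<lambda>z. exp (z * u)) (moment r N p v) L / v ^ N"
    unfolding newton_form_def X_def by (simp add: sum_negf sum_divide_distrib del: upt_Suc)
  ultimately have G: "(G has_integral - newton_form r N (\<lambda>z. exp (z * u)) (moment r N p v) L / v ^ N) {0..}"
    by simp
  define \<Phi> where "\<Phi> l' = (v / u) ^ N * exp (p * (u - v))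
     - (u - v) / u ^ N * newton_form r N (\<lambda>z. exp (z * u)) (moment r N p v) (\<lambda>i. of_real (l' i))"
    for l' :: "nat \<Rightarrow> real"
  have "ratioB N l (\<lambda>l'. Bp N 1 l' p (\<lambda>a. if a = 0 then u else 0) (\<lambda>b. if b = 0 then v else 0)) = \<Phi> l"
  proof (rule ratioB_eqI[OF hl rl])
    fix l' assume l': "weyl_strict N l'" "\<And>i. i < N \<Longrightarrow> \<bar>l' i\<bar> < r"
    have "Bp N 1 l' p (\<lambda>a. if a = 0 then u else 0) (\<lambda>b. if b = 0 then v else 0) / B N l' zeros
        = ratio1 r N p (\<lambda>m. of_real (l' m)) u zeros v"
      by (rule Bp1_over_B_zeros) (use uv r weyl_strict_imp_inj[OF l'(1)] in auto)
    also have "\<dots> = \<Phi> l'"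
      unfolding \<Phi>_def by (rule ratio1_zeros_nonzero_args)
        (use u v r l'(2) weyl_strict_imp_inj[OF l'(1)] in \<open>auto simp: inj_on_def\<close>)
    finally show "Bp N 1 l' p (\<lambda>a. if a = 0 then u else 0) (\<lambda>b. if b = 0 then v else 0) / B N l' zeros = \<Phi> l'" .
  next
    fix F :: "(nat \<Rightarrow> real) filter" assume "\<And>i. ((\<lambda>l'. l' i) \<longlongrightarrow> l i) F"
    then show "(\<Phi> \<longlongrightarrow> \<Phi> l) F"
      unfolding \<Phi>_def
      by (intro tendsto_intros tendsto_newton_form tendsto_of_real) (use rl r hol in auto)
  qed
  \<comment> \<open>The factor v^N contained in the moments is compensated by writing 1/u^N as
    (v/u)^N / v^N.\<close>
  also have "\<Phi> l = (u - v) * (v / u) ^ N * (exp (p * (u - v)) / (u - v)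
      + (- newton_form r N (\<lambda>z. exp (z * u)) (moment r N p v) L / v ^ N))"
    using u v uv by (simp add: \<Phi>_def L_def[abs_def] field_simps)
  also have "- newton_form r N (\<lambda>z. exp (z * u)) (moment r N p v) L / v ^ N = integral {0..} G"
    using G by (rule integral_unique[symmetric])
  finally show "let G = (\<lambda>t::real. let w = p + of_real t * d in
                   d * (contour_integral \<gamma>
                     (\<lambda>z. 1 / (w - z) * exp (z * u) / exp (w * v)
                          * (\<Prod>i<N. (w - of_real (l i)) / (z - of_real (l i))))
                        / (2 * of_real pi * \<i>)))
        in G integrable_on {0..} \<and>
           ratioB N l (\<lambda>l'. Bp N 1 l' p (\<lambda>a. if a = 0 then u else 0)
                                        (\<lambda>b. if b = 0 then v else 0))
           = (u - v) * (v / u) ^ N * (exp (p * (u - v)) / (u - v) + integral {0..} G)"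
    using has_integral_integrable[OF G] unfolding Let_def G_def by blast
qed

end
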